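(* Let $(\alpha_i)_{i\in\mathbb{N}}$ be a bounded sequence of complex numbers and let $T \in B(l^2(\mathbb{N}))$ be the weighted shift $T\delta_i = \alpha_i\delta_{i+1}$. Assume there is a subsequence $\{i_k\}_{k\in\mathbb{N}}$ with $|\alpha_{i_k}| \to 0$ as $k \to \infty$. Let $m$ be a positive integer, $f_j \in l^{\infty}(\mathbb{N})$ for $-m \leq j \leq m$, and $$S = f_{-m}(T^* )^m + \cdots + f_{-1}T^* + f_0 + f_1T + \cdots + f_mT^m.$$ Let $q(x) = x^m + x^{m-1} + \cdots + x$ with derivative $q'$, let $M = \max_{-m\leq j\leq m}\|f_j\|$, and let $P_k$ be the orthogonal projection onto $\mathrm{span}\{\delta_1,\ldots,\delta_{i_k}\}$. Then the following statements hold: (1) If $S$ is invertible and $|\alpha_{i_k}| < \frac{1}{\|S^{-1}\|Mq'(\|T\|)}$ then $P_kSP_k$ is invertible. (2) If $S$ is invertible, $|\alpha_{i_k}| < \frac{1}{\|S^{-1}\|Mq'(\|T\|)}$, $y \in l^2(\mathbb{N})$ is given, $x \in l^2(\mathbb{N})$ is the unique solution of $Sx = y$, $y_k = P_ky$ and $x_k$ is the unique solution of $P_kSP_kx_k = y_k$, then $$\|x_k - x\| \leq \|S^{-1}\|\big(\|y - y_k\| + \|x_k\|\,Mq'(\|T\|)\,|\alpha_{i_k}|\big).$$ (3) For every $\varepsilon > 0$, the $\varepsilon$-pseudospectra of $P_kSP_k$ converge to the $\varepsilon$-pseudospectrum of $S$, i.e. $\sigma^{(\varepsilon)}(P_kSP_k)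 \to \sigma^{(\varepsilon)}(S)$, and $\sigma^{(\varepsilon)}(P_kSP_k) \subset \sigma^{(\varepsilon + Mq'(\|T\|)|\alpha_{i_k}|)}(S)$. (4) The singular values of $P_kSP_k$ converge to the singular values of $S$, i.e. $\sigma_2(P_kSP_k) \to \sigma_2(S)$, and $\sigma_2(P_kSP_k) \subset^{\delta_k} \sigma_2(S)$, where $\delta_k = \sqrt{2\|S\|Mq'(\|T\|)|\alpha_{i_k}|}$.
   Context: $\{\delta_i\}_{i\in\mathbb{N}}$ is the canonical orthonormal basis of $l^2(\mathbb{N})$, $\mathbb{N}=\{1,2,\ldots\}$. Elements $f \in l^{\infty}(\mathbb{N})$ act on $l^2(\mathbb{N})$ as multiplication operators, $f\delta_i = f(i)\delta_i$. $P_kSP_k$ is regarded as an operator on the finite dimensional space $P_kl^2(\mathbb{N})$ (an $i_k\times i_k$ matrix), and its invertibility, the solution $x_k$ and its spectral quantities are taken there. For $\varepsilon > 0$ the $\varepsilon$-pseudospectrum of an operator $X$ is $\sigma^{(\varepsilon)}(X) = \{\lambda \in \mathbb{C} : \|(\lambda - X)^{-1}\| \geq 1/\varepsilon\}$, with the convention that $\|Y^{-1}\| = \infty$ if $Y$ is not invertible. The singular values of $X$ are $\sigma_2(X) = \{\lambda > 0 : \lambda^2 \in \sigma(X^*X)\}$. For $\Sigma \subset \mathbb{C}$ and $\delta > 0$, $N_{\delta}(\Sigma)$ denotes the $\delta$-neighborhood of $\Sigma$, i.e. the union of all (open) $\delta$-balls centered at points of $\Sigma$; for $\Sigma,\Lambda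 \subset \mathbb{C}$, $\Sigma \subset^{\delta} \Lambda$ means $\Sigma \subset N_{\delta}(\Lambda)$. Convergence of sets $\Sigma_n \to \Sigma$ means $d_H(\Sigma_n,\Sigma) \to 0$, where $d_H(\Sigma,\Lambda) = \max\{\sup_{\sigma\in\Sigma} d(\sigma,\Lambda), \sup_{\lambda\in\Lambda} d(\lambda,\Sigma)\}$ is the Hausdorff distance and $d(\sigma,\Lambda)=\inf_{\lambda\in\Lambda}|\sigma-\lambda|$.
   Formalization: (4) fails as stated, since small positive singular values of P_kSP_k may approximate 0, which σ_2(S) excludes; it is proved with λ ≥ 0 in σ_2, and with λ > 0 only if 0 is not an isolated point of σ(S*S). For δ_k = 0 the neighborhood of a set is the set itself. *)

theory Defs
  imports "HOL-Analysis.Analysis"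
begin

section \<open>The Hilbert space of square-summable complex sequences\<close>

text \<open>Sequences are indexed by \<open>0, 1, 2, \<dots>\<close> instead of \<open>1, 2, 3, \<dots>\<close>; this is only a
  relabelling of the orthonormal basis.\<close>

typedef ell2 = "{x :: nat \<Rightarrow> complex. summable (\<lambda>n. (cmod (x n))\<^sup>2)}"
  morphisms coord Abs_ell2
  by (rule exI[of _ "\<lambda>_. 0"]) simp

lemma coord_summable: "summable (\<lambda>n. (cmod (coord x n))\<^sup>2)"
  using coord by auto

lemma ell2_eqI: "(\<And>n. coord x n = coord y n) \<Longrightarrow> x = y"
  by (metis coord_inject ext)

lemma coord_Abs_ell2: "summable (\<lambda>n. (cmod (x n))\<^sup>2) \<Longrightarrow> coord (Abs_ell2 x) = x"
  by (simp add: Abs_ell2_inverse)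

lemma summable_norm_mult_coord: "summable (\<lambda>n. cmod (coord x n) * cmod (coord y n))"
proof (rule summable_comparison_test')
  show "summable (\<lambda>n. (cmod (coord x n))\<^sup>2 + (cmod (coord y n))\<^sup>2)"
    by (intro summable_add coord_summable)
next
  fix n :: nat
  have "2 * (cmod (coord x n) * cmod (coord y n)) \<le> (cmod (coord x n))\<^sup>2 + (cmod (coord y n))\<^sup>2"
    using sum_squares_bound[of "cmod (coord x n)" "cmod (coord y n)"] by (simp add: mult.assoc)
  moreover have "0 \<le> cmod (coord x n) * cmod (coord y n)" by simp
  ultimately show "norm (cmod (coord x n) * cmod (coord y n))
      \<le> (cmod (coord x n))\<^sup>2 + (cmod (coord y n))\<^sup>2"
    unfolding real_norm_def by linarith
qed

lemma summable_mult_cnj_coord: "summable (\<lambda>n. coord x n * cnj (coord y n))"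
  by (rule summable_norm_cancel) (simp add: norm_mult summable_norm_mult_coord)

lemma summable_add_coord: "summable (\<lambda>n. (cmod (coord x n + coord y n))\<^sup>2)"
proof (rule summable_comparison_test')
  show "summable (\<lambda>n. (cmod (coord x n))\<^sup>2 + 2 * (cmod (coord x n) * cmod (coord y n))
      + (cmod (coord y n))\<^sup>2)"
    by (intro summable_add summable_mult coord_summable summable_norm_mult_coord)
next
  fix n :: nat
  have "(cmod (coord x n + coord y n))\<^sup>2 \<le> (cmod (coord x n) + cmod (coord y n))\<^sup>2"
    by (intro power_mono norm_triangle_ineq) auto
  then show "norm ((cmod (coord x n + coord y n))\<^sup>2)
      \<le> (cmod (coord x n))\<^sup>2 + 2 * (cmod (coord x n) * cmod (coord y n)) + (cmod (coord y n))\<^sup>2"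
    by (simp add: power2_sum)
qed

lemma summable_scale_coord: "summable (\<lambda>n. (cmod (c * coord x n))\<^sup>2)"
  by (simp add: norm_mult power_mult_distrib coord_summable summable_mult)

definition cscale :: "complex \<Rightarrow> ell2 \<Rightarrow> ell2" (infixr \<open>*\<^sub>C\<close> 75)
  where "c *\<^sub>C x = Abs_ell2 (\<lambda>n. c * coord x n)"

definition cinner :: "ell2 \<Rightarrow> ell2 \<Rightarrow> complex"
  where "cinner x y = (\<Sum>n. coord x n * cnj (coord y n))"

text \<open>The library's inner product is real-valued, so the instance below uses the real part of
  \<open>cinner\<close>. The norm is the usual one (lemma \<open>norm_ell2\<close>).\<close>

instantiation ell2 :: real_inner
begin

definition "0 = Abs_ell2 (\<lambda>_. 0)"
definition "x + y = Abs_ell2 (\<lambda>n. coord x n + coord y n)"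
definition "- x = Abs_ell2 (\<lambda>n. - coord x n)" for x :: ell2
definition "x - y = Abs_ell2 (\<lambda>n. coord x n - coord y n)"
definition "r *\<^sub>R x = Abs_ell2 (\<lambda>n. complex_of_real r * coord x n)"
definition "inner x y = Re (cinner x y)"
definition "norm x = sqrt (inner x x)" for x :: ell2
definition "dist x y = norm (x - y)" for x y :: ell2
definition "sgn x = inverse (norm x) *\<^sub>R x" for x :: ell2
definition [code del]:
  "(uniformity :: (ell2 \<times> ell2) filter) = (INF e\<in>{0<..}. principal {(x, y). dist x y < e})"
definition [code del]:
  "open (U :: ell2 set) \<longleftrightarrow> (\<forall>x\<in>U. eventually (\<lambda>(x', y). x' = x \<longrightarrow> y \<in> U) uniformity)"

lemma coord_zero: "coord 0 n = 0"
  by (simp add: zero_ell2_def coord_Abs_ell2)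

lemma coord_add: "coord (x + y) n = coord x n + coord y n"
  by (simp add: plus_ell2_def coord_Abs_ell2 summable_add_coord)

lemma coord_uminus: "coord (- x) n = - coord x n"
  by (simp add: uminus_ell2_def coord_Abs_ell2 coord_summable)

lemma coord_diff: "coord (x - y) n = coord x n - coord y n"
proof -
  have "x - y = x + (- y)"
    by (simp add: minus_ell2_def plus_ell2_def coord_uminus)
  then show ?thesis by (simp add: coord_add coord_uminus)
qed

lemma coord_scaleR: "coord (r *\<^sub>R x) n = complex_of_real r * coord x n"
  by (simp only: scaleR_ell2_def coord_Abs_ell2[OF summable_scale_coord])

lemmas coord_simps = coord_zero coord_add coord_uminus coord_diff coord_scaleR

lemma inner_ell2: "inner x y = (\<Sum>n. Re (coord x n * cnj (coord y n)))"
  unfolding inner_ell2_def cinner_def by (rule Re_suminf[OF summable_mult_cnj_coord])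

lemma summable_inner: "summable (\<lambda>n. Re (coord x n * cnj (coord y n)))"
  using summable_mult_cnj_coord summable_Re by blast

lemma inner_self_ell2: "inner x x = (\<Sum>n. (cmod (coord x n))\<^sup>2)"
  unfolding inner_ell2 cmod_power2 by (simp add: power2_eq_square)

instance
proof
  fix x y z :: ell2 and a b r :: real
  show "dist x y = norm (x - y)" by (rule dist_ell2_def)
  show "x + y + z = x + (y + z)" by (rule ell2_eqI) (simp add: coord_simps)
  show "x + y = y + x" by (rule ell2_eqI) (simp add: coord_simps)
  show "0 + x = x" by (rule ell2_eqI) (simp add: coord_simps)
  show "- x + x = 0" by (rule ell2_eqI) (simp add: coord_simps)
  show "x - y = x + - y" by (rule ell2_eqI) (simp add: coord_simps)
  show "a *\<^sub>R (x + y) = a *\<^sub>R x + a *\<^sub>R y"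
    by (rule ell2_eqI) (simp add: coord_simps algebra_simps)
  show "(a + b) *\<^sub>R x = a *\<^sub>R x + b *\<^sub>R x"
    by (rule ell2_eqI) (simp add: coord_simps algebra_simps)
  show "a *\<^sub>R b *\<^sub>R x = (a * b) *\<^sub>R x" by (rule ell2_eqI) (simp add: coord_simps)
  show "1 *\<^sub>R x = x" by (rule ell2_eqI) (simp add: coord_simps)
  show "sgn x = inverse (norm x) *\<^sub>R x" by (rule sgn_ell2_def)
  show "uniformity = (INF e\<in>{0<..}. principal {(x :: ell2, y). dist x y < e})"
    by (rule uniformity_ell2_def)
  show "open U \<longleftrightarrow> (\<forall>x\<in>U. eventually (\<lambda>(x', y). x' = x \<longrightarrow> y \<in> U) uniformity)"
    for U :: "ell2 set" by (rule open_ell2_def)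
  show "inner x y = inner y x"
    by (simp add: inner_ell2 algebra_simps)
  show "inner (x + y) z = inner x z + inner y z"
    unfolding inner_ell2 suminf_add[OF summable_inner summable_inner]
    by (simp add: coord_simps algebra_simps)
  show "inner (r *\<^sub>R x) y = r * inner x y"
    unfolding inner_ell2 suminf_mult[OF summable_inner, symmetric]
    by (simp add: coord_simps algebra_simps)
  show "0 \<le> inner x x"
    unfolding inner_self_ell2 by (rule suminf_nonneg[OF coord_summable]) simp
  show "inner x x = 0 \<longleftrightarrow> x = 0"
  proof
    assume "inner x x = 0"
    then have "\<And>n. coord x n = 0"
      unfolding inner_self_ell2 by (subst (asm) suminf_eq_zero_iff[OF coord_summable]) auto
    then show "x = 0" by (intro ell2_eqI) (simp add: coord_simps)
  qed (simp add: inner_self_ell2 coord_simps)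
  show "norm x = sqrt (inner x x)" by (rule norm_ell2_def)
qed

end

lemma norm_ell2: "norm x = sqrt (\<Sum>n. (cmod (coord x n))\<^sup>2)"
  by (simp add: norm_ell2_def inner_self_ell2)

lemma coord_cscale: "coord (c *\<^sub>C x) n = c * coord x n"
  by (simp add: cscale_def coord_Abs_ell2[OF summable_scale_coord])

global_interpretation ell2: vector_space cscale
  defines cspan = ell2.span
  by unfold_locales (auto intro!: ell2_eqI simp: coord_cscale coord_add algebra_simps)

definition ebasis :: "nat \<Rightarrow> ell2" (\<open>\<delta>\<close>)
  where "\<delta> n = Abs_ell2 (\<lambda>k. if k = n then 1 else 0)"

lemma coord_ebasis: "coord (\<delta> n) k = (if k = n then 1 else 0)"
proof -
  have "summable (\<lambda>k. (cmod (if k = n then 1 else 0))\<^sup>2)"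
    by (rule summable_finite[of "{n}"]) auto
  then show ?thesis by (simp add: ebasis_def coord_Abs_ell2)
qed


section \<open>Operators\<close>

definition bounded_clinear :: "(ell2 \<Rightarrow> ell2) \<Rightarrow> bool"
  where "bounded_clinear A \<longleftrightarrow> bounded_linear A \<and> (\<forall>c x. A (c *\<^sub>C x) = c *\<^sub>C A x)"

text \<open>Only meaningful for bounded \<open>g\<close>.\<close>

definition mult_op :: "(nat \<Rightarrow> complex) \<Rightarrow> ell2 \<Rightarrow> ell2"
  where "mult_op g x = Abs_ell2 (\<lambda>n. g n * coord x n)"

lemma coord_mult_op:
  assumes "bounded (range g)"
  shows "coord (mult_op g x) n = g n * coord x n"
proof -
  obtain B where B: "\<And>n. cmod (g n) \<le> B"
    using assms by (auto simp: bounded_iff)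
  have "summable (\<lambda>n. (cmod (g n * coord x n))\<^sup>2)"
  proof (rule summable_comparison_test')
    show "summable (\<lambda>n. B\<^sup>2 * (cmod (coord x n))\<^sup>2)"
      by (intro summable_mult coord_summable)
    show "norm ((cmod (g n * coord x n))\<^sup>2) \<le> B\<^sup>2 * (cmod (coord x n))\<^sup>2" for n
      by (auto simp: norm_mult power_mult_distrib intro!: mult_right_mono power_mono B)
  qed
  then show ?thesis by (simp add: mult_op_def coord_Abs_ell2)
qed

definition orth_proj :: "ell2 set \<Rightarrow> ell2 \<Rightarrow> ell2"
  where "orth_proj V x = (THE v. v \<in> V \<and> (\<forall>w\<in>V. cinner (x - v) w = 0))"

text \<open>The following notions are relative to a closed subspace \<open>V\<close> that the operator maps into
  itself: the operator is regarded as an element of \<open>B(V)\<close>, and its values outside \<open>V\<close> are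
  irrelevant. For the whole space take \<open>V = UNIV\<close>.\<close>

definition invertible_on :: "ell2 set \<Rightarrow> (ell2 \<Rightarrow> ell2) \<Rightarrow> bool"
  where "invertible_on V A \<longleftrightarrow>
    bij_betw A V V \<and> (\<exists>C. \<forall>x\<in>V. norm (inv_into V A x) \<le> C * norm x)"

definition onorm_on :: "ell2 set \<Rightarrow> (ell2 \<Rightarrow> ell2) \<Rightarrow> real"
  where "onorm_on V A = (SUP x\<in>V. norm (A x) / norm x)"

lemma onorm_on_UNIV: "onorm_on UNIV A = onorm A"
  by (simp add: onorm_on_def onorm_def)

definition adjoint_on :: "ell2 set \<Rightarrow> (ell2 \<Rightarrow> ell2) \<Rightarrow> ell2 \<Rightarrow> ell2"
  where "adjoint_on V A =
    (SOME B. B ` V \<subseteq> V \<and> (\<forall>x\<in>V. \<forall>y\<in>V. cinner (A x) y = cinner x (B y)))"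

definition resolvent_op :: "complex \<Rightarrow> (ell2 \<Rightarrow> ell2) \<Rightarrow> ell2 \<Rightarrow> ell2"
  where "resolvent_op z A = (\<lambda>x. z *\<^sub>C x - A x)"

definition spectrum_on :: "ell2 set \<Rightarrow> (ell2 \<Rightarrow> ell2) \<Rightarrow> complex set"
  where "spectrum_on V A = {z. \<not> invertible_on V (resolvent_op z A)}"

text \<open>The first disjunct is the convention that the inverse of a non-invertible operator has
  norm \<open>\<infinity>\<close>.\<close>

definition pseudospectrum_on :: "ell2 set \<Rightarrow> real \<Rightarrow> (ell2 \<Rightarrow> ell2) \<Rightarrow> complex set"
  where "pseudospectrum_on V \<epsilon> A =
    {z. \<not> invertible_on V (resolvent_op z A) \<or>
        onorm_on V (inv_into V (resolvent_op z A)) \<ge> 1 / \<epsilon>}"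

text \<open>The set of strictly positive singular values, and its variant that also contains \<open>0\<close> if
  \<open>0\<close> is in the spectrum of \<open>A\<^sup>*A\<close>. The second one is needed because arbitrarily small positive
  singular values of a truncation may approximate the singular value \<open>0\<close> of the full operator:
  if the matrix of \<open>S\<close> consists of diagonal blocks with rows \<open>(a\<^sup>2, a)\<close> and \<open>(a, 1)\<close>, where
  \<open>a \<rightarrow> 0\<close> along the blocks, then the positive singular values of \<open>S\<close> are all at least \<open>1\<close>,
  whereas cutting in the middle of a block produces the singular value \<open>a\<^sup>2\<close>.\<close>

definition singular_values_on :: "ell2 set \<Rightarrow> (ell2 \<Rightarrow> ell2) \<Rightarrow> complex set"
  where "singular_values_on V A =
    {complex_of_real s |s. s > 0 \<and> (complex_of_real s)\<^sup>2 \<in> spectrum_on V (adjoint_on V A \<circ> A)}"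

definition singular_values0_on :: "ell2 set \<Rightarrow> (ell2 \<Rightarrow> ell2) \<Rightarrow> complex set"
  where "singular_values0_on V A =
    {complex_of_real s |s. s \<ge> 0 \<and> (complex_of_real s)\<^sup>2 \<in> spectrum_on V (adjoint_on V A \<circ> A)}"


section \<open>Neighbourhoods and Hausdorff distance\<close>

text \<open>For \<open>d > 0\<close> this is the union of the open balls; including \<open>X\<close> itself only matters for
  \<open>d = 0\<close>, where the neighbourhood is \<open>X\<close> rather than empty.\<close>

definition nbhd :: "real \<Rightarrow> 'a::metric_space set \<Rightarrow> 'a set"
  where "nbhd d X = X \<union> (\<Union>x\<in>X. ball x d)"

text \<open>Values in \<open>[0, \<infinity>]\<close>, so that suprema and infima over empty or unbounded sets are
  the intended ones.\<close>

definition hausdorff_dist :: "'a::metric_space set \<Rightarrow> 'a set \<Rightarrow> ennreal"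
  where "hausdorff_dist X Y =
    max (SUP x\<in>X. INF y\<in>Y. ennreal (dist x y)) (SUP y\<in>Y. INF x\<in>X. ennreal (dist y x))"

definition set_tendsto :: "(nat \<Rightarrow> 'a::metric_space set) \<Rightarrow> 'a set \<Rightarrow> bool"
  where "set_tendsto X Y \<longleftrightarrow> (\<lambda>k. hausdorff_dist (X k) Y) \<longlonglongrightarrow> 0"

end

theory Submission
  imports Defs
begin

text \<open>Let \<open>P = P\<^sub>k\<close> and \<open>c\<^sub>k = M q'(\<parallel>T\<parallel>) \<bar>\<alpha>\<^bsub>i\<^sub>k\<^esub>\<bar>\<close>. Powers of \<open>T\<^sup>*\<close> leave the range of \<open>P\<close> invariant, and powers
  of \<open>T\<close> leave it only through the small weight \<open>\<alpha>\<^bsub>i\<^sub>k\<^esub>\<close>, so \<open>(1 - P) S P\<close> and \<open>(1 - P) S\<^sup>* P\<close> have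
  norm at most \<open>c\<^sub>k\<close>. This gives (1), (2) and the inclusion in (3) directly. Conversely, lower bounds
  for \<open>z - P S P\<close> along infinitely many \<open>k\<close> pass to \<open>z - S\<close>, together with surjectivity; since the
  norm of the resolvent of \<open>S\<close> is not constant on any open set, this yields the convergence of the
  pseudospectra. For the singular values, \<open>S\<^sup>* S\<close> differs from its truncated version by at most
  \<open>2 \<parallel>S\<parallel> c\<^sub>k\<close> on the range of \<open>P\<close>, and both are self-adjoint, so that distances to the spectrum are
  controlled by approximate eigenvectors.\<close>

section \<open>The space of square-summable sequences\<close>

text \<open>Inverses on different subspaces are awkward to compare, so invertibility and resolvent
  norms are recast as surjectivity plus lower bounds \<open>e * norm x \<le> norm (B x)\<close>,
  which survive perturbations of size \<open>c k\<close> and limits. On the range of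
  \<open>P\<close> a lower bound forces surjectivity by finite dimension; on the whole space it does
  not, so surjectivity has to be carried along. A lower bound obtained as a limit loses its
  strictness, while staying outside a pseudospectrum demands a strict one: this is the gap that the
  non-constancy of the resolvent norm closes. In (4) the neighbourhoods consist of open balls of
  exactly the stated radius, so the comparison of the squares has to be strict as well; the square
  root in that radius comes from passing from squares back to singular values. If 0 is isolated in
  the spectrum of the adjoint of S times S, small positive singular values of a truncation may be
  close to 0 alone, whence the two versions of (4).\<close>

lemma norm_cscale: "norm (c *\<^sub>C x) = cmod c * norm x"
proof -
  have "norm (c *\<^sub>C x) = sqrt ((cmod c)\<^sup>2 * (\<Sum>n. (cmod (coord x n))\<^sup>2))"
    unfolding norm_ell2 coord_cscale norm_mult power_mult_distrib
    by (simp add: suminf_mult[OF coord_summable])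
  then show ?thesis
    by (simp add: norm_ell2 real_sqrt_mult)
qed

lemma scaleR_eq_cscale: "r *\<^sub>R x = complex_of_real r *\<^sub>C x"
  by (rule ell2_eqI) (simp add: coord_simps coord_cscale)

lemma cscale_simps [simp]:
  "c *\<^sub>C (0::ell2) = 0" "0 *\<^sub>C x = 0" "1 *\<^sub>C x = x" "(-1) *\<^sub>C x = - x"
  by (auto intro!: ell2_eqI simp: coord_simps coord_cscale)

lemma cscale_add_right: "c *\<^sub>C (x + y) = c *\<^sub>C x + c *\<^sub>C y"
  and cscale_diff_right: "c *\<^sub>C (x - y) = c *\<^sub>C x - c *\<^sub>C y"
  and cscale_add_left: "(b + c) *\<^sub>C x = b *\<^sub>C x + c *\<^sub>C x"
  and cscale_diff_left: "(b - c) *\<^sub>C x = b *\<^sub>C x - c *\<^sub>C x"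
  and cscale_minus_left: "(- c) *\<^sub>C x = - (c *\<^sub>C x)"
  and cscale_cscale: "b *\<^sub>C c *\<^sub>C x = (b * c) *\<^sub>C x"
  by (auto intro!: ell2_eqI simp: coord_simps coord_cscale algebra_simps)

lemma inner_cscale_left: "inner (c *\<^sub>C x) y = inner x (cnj c *\<^sub>C y)"
  by (simp add: inner_ell2 coord_cscale algebra_simps)

lemma inner_ii_self: "inner (\<i> *\<^sub>C x) x = 0"
  using inner_cscale_left[of \<i> x x] by (simp add: cscale_minus_left inner_commute)

lemma cinner_eq: "cinner x y = Complex (inner x y) (inner x (\<i> *\<^sub>C y))"
proof (rule complex_eqI)
  have "Im (cinner x y) = (\<Sum>n. Im (coord x n * cnj (coord y n)))"
    unfolding cinner_def by (rule Im_suminf[OF summable_mult_cnj_coord])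
  then show "Im (cinner x y) = Im (Complex (inner x y) (inner x (\<i> *\<^sub>C y)))"
    by (simp add: inner_ell2 coord_cscale)
qed (simp add: inner_ell2_def)

lemma norm_coord_le: "cmod (coord x n) \<le> norm x"
proof -
  have "(cmod (coord x n))\<^sup>2 \<le> (\<Sum>n. (cmod (coord x n))\<^sup>2)"
    using sum_le_suminf[OF coord_summable, of "{n}" x] by simp
  then show ?thesis
    by (simp add: norm_ell2 real_le_rsqrt)
qed

lemma bounded_linear_coord: "bounded_linear (\<lambda>x. coord x n)"
proof (rule bounded_linear_intro[where K=1])
  show "coord (r *\<^sub>R x) n = r *\<^sub>R coord x n" for r x
    by (simp add: coord_simps scaleR_conv_of_real)
qed (simp_all add: coord_simps norm_coord_le)

lemma coord_sum: "coord (sum x J) n = (\<Sum>j\<in>J. coord (x j) n)"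
  by (rule linear_sum[OF bounded_linear.linear[OF bounded_linear_coord]])

text \<open>Membership in the space and the norm bound come together from finite partial sums;
  limits, multiplication operators and the left shift are all built this way.\<close>

lemma ell2_of_bounded_sums:
  assumes "\<And>N. (\<Sum>n<N. (cmod (x n))\<^sup>2) \<le> K\<^sup>2" "K \<ge> 0"
  shows "summable (\<lambda>n. (cmod (x n))\<^sup>2)" "norm (Abs_ell2 x) \<le> K"
proof -
  show s: "summable (\<lambda>n. (cmod (x n))\<^sup>2)"
    by (rule summableI_nonneg_bounded[where x = "K\<^sup>2"]) (use assms in auto)
  have "(\<Sum>n. (cmod (x n))\<^sup>2) \<le> K\<^sup>2"
    by (rule suminf_le_const[OF s assms(1)])
  then show "norm (Abs_ell2 x) \<le> K"
    by (simp add: norm_ell2 coord_Abs_ell2[OF s] assms(2) real_le_lsqrt suminf_nonneg[OF s])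
qed

lemma sum_coord_le_norm: "(\<Sum>n<N. (cmod (coord x n))\<^sup>2) \<le> (norm x)\<^sup>2"
  using sum_le_suminf[OF coord_summable, of "{..<N}" x]
  by (simp add: norm_ell2 suminf_nonneg[OF coord_summable])

instance ell2 :: complete_space
proof
  fix X :: "nat \<Rightarrow> ell2"
  assume X: "Cauchy X"
  define l where "l n = lim (\<lambda>j. coord (X j) n)" for n
  have l: "(\<lambda>j. coord (X j) n) \<longlonglongrightarrow> l n" for n
    unfolding l_def using bounded_linear.Cauchy[OF bounded_linear_coord X]
    by (metis Cauchy_convergent convergent_LIMSEQ_iff)
  \<comment> \<open>For fixed \<open>j\<close> and \<open>N\<close> let \<open>k\<close> tend to
    infinity in the Cauchy estimate: only finite sums are involved, so no limit is exchanged with an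
    infinite sum.\<close>
  have close: "\<exists>J. \<forall>j\<ge>J. \<forall>N. (\<Sum>n<N. (cmod (coord (X j) n - l n))\<^sup>2) \<le> e\<^sup>2" if e: "e > 0" for e
  proof -
    obtain J where J: "\<And>j k. j \<ge> J \<Longrightarrow> k \<ge> J \<Longrightarrow> norm (X j - X k) < e"
      using CauchyD[OF X e] by blast
    have "(\<Sum>n<N. (cmod (coord (X j) n - l n))\<^sup>2) \<le> e\<^sup>2" if "j \<ge> J" for j N
    proof (rule tendsto_upperbound)
      show "(\<lambda>k. \<Sum>n<N. (cmod (coord (X j) n - coord (X k) n))\<^sup>2)
          \<longlonglongrightarrow> (\<Sum>n<N. (cmod (coord (X j) n - l n))\<^sup>2)"
        by (intro tendsto_intros l)
      have "(\<Sum>n<N. (cmod (coord (X j) n - coord (X k) n))\<^sup>2) \<le> e\<^sup>2" if "k \<ge> J" for k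
      proof -
        have "(norm (X j - X k))\<^sup>2 \<le> e\<^sup>2"
          using J[OF \<open>j \<ge> J\<close> that] by (intro power_mono) auto
        then show ?thesis
          using sum_coord_le_norm[of "X j - X k" N] by (simp add: coord_simps)
      qed
      then show "\<forall>\<^sub>F k in sequentially. (\<Sum>n<N. (cmod (coord (X j) n - coord (X k) n))\<^sup>2) \<le> e\<^sup>2"
        using eventually_sequentially by blast
    qed simp
    then show ?thesis by blast
  qed
  obtain J where "\<And>N. (\<Sum>n<N. (cmod (coord (X J) n - l n))\<^sup>2) \<le> 1\<^sup>2"
    using close[of 1] by auto
  from ell2_of_bounded_sums(1)[OF this]
  have "coord (Abs_ell2 (\<lambda>n. coord (X J) n - l n)) = (\<lambda>n. coord (X J) n - l n)"
    by (simp add: coord_Abs_ell2)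
  then have L: "coord (X J - Abs_ell2 (\<lambda>n. coord (X J) n - l n)) n = l n" for n
    by (simp add: coord_simps)
  \<comment> \<open>Only the difference between \<open>X J\<close> and the pointwise limit is known
    to be square summable so far, so the limit is written as \<open>X J\<close> minus that
    difference.\<close>
  define L where "L = X J - Abs_ell2 (\<lambda>n. coord (X J) n - l n)"
  have "X \<longlonglongrightarrow> L"
  proof (rule LIMSEQ_I)
    fix e :: real assume "e > 0"
    then obtain J where J: "\<And>j N. j \<ge> J \<Longrightarrow> (\<Sum>n<N. (cmod (coord (X j) n - l n))\<^sup>2) \<le> (e/2)\<^sup>2"
      using close[of "e/2"] by auto
    have "norm (X j - L) < e" if "j \<ge> J" for j
    proof -
      have "Abs_ell2 (\<lambda>n. coord (X j) n - l n) = X j - L"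
        by (metis (no_types, lifting) L L_def coord_diff coord_inverse ext)
      then show ?thesis
        using ell2_of_bounded_sums(2)[OF J[OF that]] \<open>e > 0\<close> by simp
    qed
    then show "\<exists>J. \<forall>j\<ge>J. norm (X j - L) < e" by blast
  qed
  then show "convergent X" by (rule convergentI)
qed

subsection \<open>Bounded operators\<close>

lemma bounded_clinearI:
  assumes "\<And>x y. A (x + y) = A x + A y" "\<And>c x. A (c *\<^sub>C x) = c *\<^sub>C A x"
    and "\<And>x. norm (A x) \<le> K * norm x"
  shows "bounded_clinear A"
  unfolding bounded_clinear_def using assms
  by (auto intro!: bounded_linear_intro[where K=K] simp: scaleR_eq_cscale mult.commute)

lemma bounded_clinearD:
  assumes "bounded_clinear A"
  shows "bounded_linear A" "A (c *\<^sub>C x) = c *\<^sub>C A x" "A (x + y) = A x + A y"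
    "A (x - y) = A x - A y" "A (- x) = - A x" "A 0 = 0" "A (r *\<^sub>R x) = r *\<^sub>R A x"
    "norm (A x) \<le> onorm A * norm x" "onorm A \<ge> 0"
proof -
  show b: "bounded_linear A" and c: "A (c *\<^sub>C x) = c *\<^sub>C A x"
    using assms by (auto simp: bounded_clinear_def)
  then interpret bounded_linear A by simp
  show "A (x + y) = A x + A y" "A (x - y) = A x - A y" "A (- x) = - A x" "A 0 = 0"
    "A (r *\<^sub>R x) = r *\<^sub>R A x"
    by (simp_all add: add diff neg zero scaleR)
  show "norm (A x) \<le> onorm A * norm x" "onorm A \<ge> 0"
    by (rule onorm[OF b] onorm_pos_le[OF b])+
qed

lemma bounded_clinear_id: "bounded_clinear (\<lambda>x. x)"
  by (auto simp: bounded_clinear_def)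

lemma bounded_clinear_zero: "bounded_clinear (\<lambda>x. 0)"
  by (auto simp: bounded_clinear_def)

lemma bounded_clinear_compose:
  assumes "bounded_clinear A" "bounded_clinear B"
  shows "bounded_clinear (\<lambda>x. A (B x))"
  using assms bounded_linear_compose[of A B] by (auto simp: bounded_clinear_def)

lemma bounded_clinear_add:
  assumes "bounded_clinear A" "bounded_clinear B"
  shows "bounded_clinear (\<lambda>x. A x + B x)"
  using assms by (auto simp: bounded_clinear_def cscale_add_right bounded_linear_add)

lemma bounded_clinear_diff:
  assumes "bounded_clinear A" "bounded_clinear B"
  shows "bounded_clinear (\<lambda>x. A x - B x)"
  using assms by (auto simp: bounded_clinear_def cscale_diff_right bounded_linear_sub)

lemma bounded_clinear_cscale: "bounded_clinear (\<lambda>x. c *\<^sub>C x)"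
  by (rule bounded_clinearI[where K="cmod c"])
    (simp_all add: cscale_add_right cscale_cscale norm_cscale mult.commute)

lemma bounded_clinear_resolvent_op: "bounded_clinear A \<Longrightarrow> bounded_clinear (resolvent_op z A)"
  unfolding resolvent_op_def by (intro bounded_clinear_diff bounded_clinear_cscale)

text \<open>Every adjoint needed below has an explicit formula, so it is carried as a second
  operator. The real inner product suffices because both operators are complex linear.\<close>

definition adjoint_pair :: "(ell2 \<Rightarrow> ell2) \<Rightarrow> (ell2 \<Rightarrow> ell2) \<Rightarrow> bool"
  where "adjoint_pair A B \<longleftrightarrow>
    bounded_clinear A \<and> bounded_clinear B \<and> (\<forall>x y. inner (A x) y = inner x (B y))"

lemma adjoint_pair_inner:
  assumes "adjoint_pair A B"
  shows "inner (A x) y = inner x (B y)"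
  using assms by (simp add: adjoint_pair_def)

lemma adjoint_pair_sym: "adjoint_pair A B \<Longrightarrow> adjoint_pair B A"
  unfolding adjoint_pair_def by (metis inner_commute)

lemma adjoint_pair_id: "adjoint_pair (\<lambda>x. x) (\<lambda>x. x)"
  by (simp add: adjoint_pair_def bounded_clinear_id)

lemma adjoint_pair_compose:
  assumes "adjoint_pair A A'" "adjoint_pair B B'"
  shows "adjoint_pair (\<lambda>x. A (B x)) (\<lambda>x. B' (A' x))"
  using assms by (simp add: adjoint_pair_def bounded_clinear_compose)

lemma adjoint_pair_add:
  assumes "adjoint_pair A A'" "adjoint_pair B B'"
  shows "adjoint_pair (\<lambda>x. A x + B x) (\<lambda>x. A' x + B' x)"
  using assms by (simp add: adjoint_pair_def bounded_clinear_add inner_add_left inner_add_right)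

lemma adjoint_pair_diff:
  assumes "adjoint_pair A A'" "adjoint_pair B B'"
  shows "adjoint_pair (\<lambda>x. A x - B x) (\<lambda>x. A' x - B' x)"
  using assms by (simp add: adjoint_pair_def bounded_clinear_diff inner_diff_left inner_diff_right)

lemma adjoint_pair_sum:
  assumes "\<And>j. j \<in> J \<Longrightarrow> adjoint_pair (A j) (B j)"
  shows "adjoint_pair (\<lambda>x. \<Sum>j\<in>J. A j x) (\<lambda>x. \<Sum>j\<in>J. B j x)"
  using assms
proof (induction J rule: infinite_finite_induct)
  case (insert j J)
  then show ?case
    by (simp add: adjoint_pair_add)
qed (simp_all add: adjoint_pair_def bounded_clinear_zero)

lemma adjoint_pair_cscale: "adjoint_pair (\<lambda>x. c *\<^sub>C x) (\<lambda>x. cnj c *\<^sub>C x)"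
  by (simp add: adjoint_pair_def bounded_clinear_cscale inner_cscale_left)

lemma adjoint_pair_funpow:
  assumes "adjoint_pair A B"
  shows "adjoint_pair (A ^^ j) (B ^^ j)"
proof (induction j)
  case 0
  then show ?case
    by (simp add: id_def adjoint_pair_id)
next
  case (Suc j)
  from adjoint_pair_compose[OF assms this]
  have "adjoint_pair (A ^^ Suc j) (\<lambda>x. (B ^^ j) (B x))"
    by (simp add: o_def)
  then show ?case
    by (metis (no_types, lifting) comp_apply ext funpow_Suc_right)
qed

lemma adjoint_pair_norm_le:
  assumes "adjoint_pair A B" and A: "\<And>x. norm (A x) \<le> K * norm x"
  shows "norm (B x) \<le> K * norm x"
proof (cases "B x = 0")
  case True
  have "0 \<le> K * norm x" using A[of x] norm_ge_zero order_trans by blast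
  then show ?thesis using True by simp
next
  case False
  have "norm (B x) * norm (B x) = inner (A (B x)) x"
    using assms(1) by (simp add: adjoint_pair_inner power2_norm_eq_inner flip: power2_eq_square)
  also have "\<dots> \<le> norm (A (B x)) * norm x" by (rule norm_cauchy_schwarz)
  also have "\<dots> \<le> (K * norm (B x)) * norm x" by (intro mult_right_mono A) simp
  finally show ?thesis using False by (simp add: algebra_simps)
qed

text \<open>Complex linearity of \<open>B\<close> recovers the imaginary part of the complex inner product.\<close>

lemma adjoint_pair_cinner:
  assumes "adjoint_pair A B"
  shows "cinner (A x) y = cinner x (B y)"
  using assms by (simp add: cinner_eq adjoint_pair_def bounded_clinearD(2))

text \<open>The chosen adjoint is pinned down on \<open>V\<close> only: there its difference from
  \<open>B y\<close> lies in \<open>V\<close> and may be tested against itself.\<close>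

lemma adjoint_on_eq:
  assumes AB: "adjoint_pair A B" and V: "ell2.subspace V" "B ` V \<subseteq> V" and y: "y \<in> V"
  shows "adjoint_on V A y = B y"
proof -
  let ?P = "\<lambda>B. B ` V \<subseteq> V \<and> (\<forall>x\<in>V. \<forall>y\<in>V. cinner (A x) y = cinner x (B y))"
  have "?P (adjoint_on V A)"
    unfolding adjoint_on_def by (rule someI[of ?P B]) (use AB V adjoint_pair_cinner in auto)
  then have C: "adjoint_on V A y \<in> V"
    and eq: "\<And>x. x \<in> V \<Longrightarrow> cinner x (B y) = cinner x (adjoint_on V A y)"
    using y AB by (auto simp: adjoint_pair_cinner)
  let ?d = "B y - adjoint_on V A y"
  have "?d \<in> V"
    using V y C by (auto intro: ell2.subspace_diff)
  from eq[OF this] have "inner ?d ?d = 0"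
    by (simp add: cinner_eq inner_diff_right)
  then show ?thesis by simp
qed

section \<open>Multiplication operators\<close>

lemma mult_op_norm_le:
  assumes "bounded (range g)" "\<And>n. cmod (g n) \<le> K"
  shows "norm (mult_op g x) \<le> K * norm x"
proof -
  have "K \<ge> 0" using assms(2)[of 0] norm_ge_zero order_trans by blast
  have "(\<Sum>n<N. (cmod (g n * coord x n))\<^sup>2) \<le> (K * norm x)\<^sup>2" for N
  proof -
    have "(\<Sum>n<N. (cmod (g n * coord x n))\<^sup>2) \<le> (\<Sum>n<N. K\<^sup>2 * (cmod (coord x n))\<^sup>2)"
      by (intro sum_mono)
        (auto simp: norm_mult power_mult_distrib intro!: mult_right_mono power_mono assms)
    also have "\<dots> \<le> (K * norm x)\<^sup>2"
      unfolding sum_distrib_left[symmetric] power_mult_distrib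
      by (intro mult_left_mono sum_coord_le_norm) simp
    finally show ?thesis .
  qed
  then show ?thesis
    unfolding mult_op_def using \<open>K \<ge> 0\<close> by (intro ell2_of_bounded_sums) auto
qed

lemma bounded_clinear_mult_op:
  assumes "bounded (range g)"
  shows "bounded_clinear (mult_op g)"
proof -
  obtain K where K: "\<And>n. cmod (g n) \<le> K"
    using assms by (auto simp: bounded_iff)
  show ?thesis
    by (rule bounded_clinearI[where K=K])
      (auto intro!: ell2_eqI mult_op_norm_le K
        simp: coord_mult_op assms coord_simps coord_cscale algebra_simps)
qed

lemma bounded_range_cnj: "bounded (range g) \<Longrightarrow> bounded (range (\<lambda>n. cnj (g n)))"
  by (auto simp: bounded_iff)

lemma adjoint_pair_mult_op:
  assumes "bounded (range g)"
  shows "adjoint_pair (mult_op g) (mult_op (\<lambda>n. cnj (g n)))"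
  using assms bounded_range_cnj[OF assms]
  by (simp add: adjoint_pair_def bounded_clinear_mult_op inner_ell2 coord_mult_op algebra_simps)

section \<open>Invertibility and lower bounds\<close>

text \<open>Removes the inverse from the definition. The constant \<open>c\<close> is the reciprocal
  of a bound for the inverse.\<close>

lemma invertible_on_iff:
  assumes B: "bounded_clinear B" and V: "ell2.subspace V" "B ` V \<subseteq> V"
  shows "invertible_on V B \<longleftrightarrow> V \<subseteq> B ` V \<and> (\<exists>c>0. \<forall>x\<in>V. c * norm x \<le> norm (B x))"
proof
  assume inv: "invertible_on V B"
  then have inj: "inj_on B V" and surj: "B ` V = V"
    by (auto simp: invertible_on_def bij_betw_def)
  obtain C where C: "\<And>x. x \<in> V \<Longrightarrow> norm (inv_into V B x) \<le> C * norm x"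
    using inv by (auto simp: invertible_on_def)
  \<comment> \<open>\<open>C\<close> may be zero or negative when \<open>V\<close> is trivial, so it
    is replaced by a positive number before dividing.\<close>
  have "1 / (\<bar>C\<bar> + 1) * norm x \<le> norm (B x)" if "x \<in> V" for x
  proof -
    have "norm x \<le> C * norm (B x)"
      using C[of "B x"] that V inj by (auto simp: inv_into_f_f)
    also have "\<dots> \<le> (\<bar>C\<bar> + 1) * norm (B x)"
      by (intro mult_right_mono) auto
    finally show ?thesis by (simp add: field_simps)
  qed
  then show "V \<subseteq> B ` V \<and> (\<exists>c>0. \<forall>x\<in>V. c * norm x \<le> norm (B x))"
    using surj by (auto intro!: exI[of _ "1 / (\<bar>C\<bar> + 1)"])
next
  assume "V \<subseteq> B ` V \<and> (\<exists>c>0. \<forall>x\<in>V. c * norm x \<le> norm (B x))"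
  then obtain c where surj: "B ` V = V" and "c > 0" and c: "\<And>x. x \<in> V \<Longrightarrow> c * norm x \<le> norm (B x)"
    using V by blast
  have inj: "inj_on B V"
  proof (rule inj_onI)
    fix x y assume "x \<in> V" "y \<in> V" "B x = B y"
    then have "c * norm (x - y) \<le> 0"
      using c[of "x - y"] ell2.subspace_diff[OF V(1)] by (simp add: bounded_clinearD(4)[OF B])
    then show "x = y"
      using \<open>c > 0\<close> by (simp add: mult_le_0_iff)
  qed
  have "norm (inv_into V B x) \<le> 1 / c * norm x" if "x \<in> V" for x
    using c[of "inv_into V B x"] inv_into_into[of x B V] f_inv_into_f[of x B V] that surj \<open>c > 0\<close>
    by (simp add: field_simps)
  then show "invertible_on V B"
    unfolding invertible_on_def bij_betw_def using inj surj by blast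
qed

text \<open>The Lax-Milgram argument: solving \<open>G x = y\<close> is a fixed point problem for
  \<open>x - t *\<^sub>R (G x - y)\<close>, a contraction for a suitable \<open>t\<close>.\<close>

lemma coercive_imp_surj:
  assumes G: "bounded_clinear G" and V: "ell2.subspace V" "complete V" "G ` V \<subseteq> V"
    and c: "c > 0" "\<And>x. x \<in> V \<Longrightarrow> c * (norm x)\<^sup>2 \<le> inner (G x) x"
  shows "V \<subseteq> G ` V"
proof
  fix y assume y: "y \<in> V"
  obtain K where K: "K > 0" "\<And>x. norm (G x) \<le> K * norm x"
    using bounded_linear.pos_bounded[OF bounded_clinearD(1)[OF G]] by (auto simp: mult.commute)
  \<comment> \<open>This \<open>t\<close> minimises
    \<open>1 - 2 * t * c + t\<^sup>2 * K\<^sup>2\<close>, the bound for the squared contraction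
    factor. The maximum with 0 in \<open>\<rho>\<close> covers trivial \<open>V\<close>, where
    \<open>c\<close> may exceed \<open>K\<close>.\<close>
  define t where "t = c / K\<^sup>2"
  define \<rho> where "\<rho> = max 0 (1 - c\<^sup>2 / K\<^sup>2)"
  have t: "t > 0" using c K by (simp add: t_def)
  have \<rho>: "0 \<le> \<rho>" "\<rho> < 1" using c K by (auto simp: \<rho>_def)
  have contr: "norm (d - t *\<^sub>R G d) \<le> sqrt \<rho> * norm d" if "d \<in> V" for d
  proof -
    have "(norm (d - t *\<^sub>R G d))\<^sup>2 = (norm d)\<^sup>2 - 2 * t * inner (G d) d + t\<^sup>2 * (norm (G d))\<^sup>2"
      unfolding power2_norm_eq_inner
      by (simp add: inner_diff_left inner_diff_right inner_commute algebra_simps power2_eq_square)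
    also have "\<dots> \<le> (norm d)\<^sup>2 - 2 * t * (c * (norm d)\<^sup>2) + t\<^sup>2 * (K * norm d)\<^sup>2"
      using t c(2)[OF that] K(2)[of d]
      by (intro add_mono diff_mono mult_left_mono power_mono) auto
    also have "\<dots> = (1 - c\<^sup>2 / K\<^sup>2) * (norm d)\<^sup>2"
      using K(1) by (simp add: t_def field_simps power2_eq_square)
    also have "\<dots> \<le> \<rho> * (norm d)\<^sup>2"
      by (intro mult_right_mono) (auto simp: \<rho>_def)
    also have "\<dots> = (sqrt \<rho> * norm d)\<^sup>2"
      using \<rho> by (simp add: power_mult_distrib)
    finally show ?thesis
      by (rule power2_le_imp_le) (use \<rho> in auto)
  qed
  have "\<exists>!x\<in>V. x - t *\<^sub>R (G x - y) = x"
  proof (rule Banach_fix)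
    show "0 \<le> sqrt \<rho>" "sqrt \<rho> < 1" using \<rho> by auto
    show "(\<lambda>x. x - t *\<^sub>R (G x - y)) ` V \<subseteq> V"
      using V y by (auto simp: scaleR_eq_cscale intro!: ell2.subspace_diff ell2.subspace_scale)
    show "dist (x - t *\<^sub>R (G x - y)) (x' - t *\<^sub>R (G x' - y)) \<le> sqrt \<rho> * dist x x'"
      if "x \<in> V" "x' \<in> V" for x x'
      using contr[of "x - x'"] that V
      by (simp add: ell2.subspace_diff dist_norm bounded_clinearD(4)[OF G] algebra_simps)
  qed (use V y in auto)
  then obtain x where "x \<in> V" "t *\<^sub>R (G x - y) = 0" by (auto simp: algebra_simps)
  then show "y \<in> G ` V" using t by auto
qed

text \<open>A lower bound for \<open>B'\<close> makes the composition of \<open>B\<close> after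
  \<open>B'\<close> coercive, hence onto \<open>V\<close>; its range lies in that of
  \<open>B\<close>.\<close>

lemma adjoint_bounded_below_imp_surj:
  assumes BB: "adjoint_pair B B'" and V: "ell2.subspace V" "complete V" "B ` V \<subseteq> V" "B' ` V \<subseteq> V"
    and c: "c > 0" "\<And>x. x \<in> V \<Longrightarrow> c * norm x \<le> norm (B' x)"
  shows "V \<subseteq> B ` V"
proof -
  have "V \<subseteq> (\<lambda>x. B (B' x)) ` V"
  proof (rule coercive_imp_surj[where c = "c\<^sup>2"])
    show "bounded_clinear (\<lambda>x. B (B' x))"
      using BB by (simp add: adjoint_pair_def bounded_clinear_compose)
    show "c\<^sup>2 * (norm x)\<^sup>2 \<le> inner (B (B' x)) x" if "x \<in> V" for x
    proof -
      have "(c * norm x)\<^sup>2 \<le> (norm (B' x))\<^sup>2"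
        using c that by (intro power_mono) auto
      then show ?thesis
        by (simp add: adjoint_pair_inner[OF BB] power2_norm_eq_inner[symmetric] power_mult_distrib)
    qed
  qed (use V c in auto)
  then show ?thesis using V by blast
qed

section \<open>Operator norms on subspaces, and pseudospectra through lower bounds\<close>

lemma resolvent_op_image_subset:
  assumes "ell2.subspace V" "A ` V \<subseteq> V"
  shows "resolvent_op z A ` V \<subseteq> V"
  using assms by (auto simp: resolvent_op_def intro!: ell2.subspace_diff ell2.subspace_scale)

text \<open>The supremum defining \<open>onorm_on\<close> is real-valued and can be trusted only if
  the quotients are bounded; \<open>C\<close> guarantees this.\<close>

lemma onorm_on_bound:
  assumes "\<And>x. x \<in> V \<Longrightarrow> norm (A x) \<le> C * norm x" and "x \<in> V"
  shows "norm (A x) \<le> onorm_on V A * norm x"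
proof (cases "norm x = 0")
  case True
  then show ?thesis using assms(1)[OF assms(2)] by simp
next
  case False
  have "norm (A y) / norm y \<le> \<bar>C\<bar>" if "y \<in> V" for y
    using order_trans[OF assms(1)[OF that] mult_right_mono[of C "\<bar>C\<bar>" "norm y"]]
    by (auto simp: divide_le_eq)
  then have "norm (A x) / norm x \<le> onorm_on V A"
    unfolding onorm_on_def using assms(2) by (intro cSUP_upper) (auto simp: bdd_above_def)
  then show ?thesis using False by (simp add: field_simps)
qed

lemma onorm_on_le:
  assumes "\<And>x. x \<in> V \<Longrightarrow> norm (A x) \<le> C * norm x" and "C \<ge> 0" "V \<noteq> {}"
  shows "onorm_on V A \<le> C"
  unfolding onorm_on_def using assms by (intro cSUP_least) (auto simp: divide_le_eq)

lemma notin_pseudospectrum_on_iff: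
  assumes A: "bounded_clinear A" and V: "ell2.subspace V" "A ` V \<subseteq> V" and \<epsilon>: "\<epsilon> > 0"
  shows "z \<notin> pseudospectrum_on V \<epsilon> A \<longleftrightarrow>
    V \<subseteq> resolvent_op z A ` V \<and> (\<exists>e>\<epsilon>. \<forall>x\<in>V. e * norm x \<le> norm (resolvent_op z A x))"
    (is "?L \<longleftrightarrow> ?R")
proof -
  let ?B = "resolvent_op z A"
  have B: "bounded_clinear ?B" "?B ` V \<subseteq> V"
    using A V by (auto simp: bounded_clinear_resolvent_op resolvent_op_image_subset)
  note inv_iff = invertible_on_iff[OF B(1) V(1) B(2)]
  have V0: "V \<noteq> {}" using V(1) ell2.subspace_0 by blast
  show ?thesis
  proof
    assume ?L
    then have inv: "invertible_on V ?B" and s: "onorm_on V (inv_into V ?B) < 1 / \<epsilon>"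
      by (auto simp: pseudospectrum_on_def)
    \<comment> \<open>The second argument keeps \<open>s\<close> positive even if the norm of the
      inverse is 0, which happens on the trivial space.\<close>
    define s where "s = max (onorm_on V (inv_into V ?B)) (1 / (2 * \<epsilon>))"
    have s: "0 < s" "s < 1 / \<epsilon>"
      using s \<epsilon> by (auto simp: s_def frac_less2 less_max_iff_disj)
    obtain C where C: "\<And>x. x \<in> V \<Longrightarrow> norm (inv_into V ?B x) \<le> C * norm x"
      and bij: "bij_betw ?B V V"
      using inv by (auto simp: invertible_on_def)
    have "1 / s * norm x \<le> norm (?B x)" if x: "x \<in> V" for x
    proof -
      have "norm x \<le> onorm_on V (inv_into V ?B) * norm (?B x)"
        using onorm_on_bound[OF C, where x = "?B x"] x bij by (auto simp: bij_betw_def)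
      also have "\<dots> \<le> s * norm (?B x)"
        by (intro mult_right_mono) (auto simp: s_def)
      finally show ?thesis using s by (simp add: field_simps)
    qed
    moreover have "1 / s > \<epsilon>" using s \<epsilon> by (simp add: field_simps)
    ultimately show ?R using inv inv_iff by blast
  next
    assume ?R
    then obtain e where surj: "V \<subseteq> ?B ` V" and e: "e > \<epsilon>"
      and le: "\<And>x. x \<in> V \<Longrightarrow> e * norm x \<le> norm (?B x)" by blast
    from e \<epsilon> have e0: "e > 0" by simp
    have "norm (inv_into V ?B x) \<le> 1 / e * norm x" if "x \<in> V" for x
      using le[of "inv_into V ?B x"] inv_into_into[of x ?B V] f_inv_into_f[of x ?B V] that surj e0
      by (simp add: field_simps subset_iff)
    from onorm_on_le[OF this] have "onorm_on V (inv_into V ?B) \<le> 1 / e"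
      using e0 V0 by simp
    also have "\<dots> < 1 / \<epsilon>" using e \<epsilon> by (simp add: frac_less2)
    finally have "onorm_on V (inv_into V ?B) < 1 / \<epsilon>" .
    moreover have "invertible_on V ?B"
      unfolding inv_iff using surj le e0 by blast
    ultimately show ?L by (simp add: pseudospectrum_on_def)
  qed
qed

section \<open>The resolvent norm is nowhere locally constant\<close>

text \<open>With \<open>B b = a\<close> and \<open>B c = b\<close>, the vectors \<open>v\<^sub>h = a - h b + h\<^sup>2 c\<close> are second order
  approximations of the value of the resolvent at \<open>B a\<close>: they satisfy \<open>(B + h) v\<^sub>h = B a + h\<^sup>3 c\<close>.
  Averaging their squared norms over four points \<open>h\<close> of a circle of radius \<open>r\<close> produces the gain
  \<open>r\<^sup>2 \<parallel>b\<parallel>\<^sup>2\<close>, which beats the error of order \<open>r\<^sup>3\<close>.\<close>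

lemma bounded_below_near_imp_strict:
  assumes B: "bounded_clinear B" and surj: "surj B" and "\<epsilon> > 0" "\<rho> > 0"
    and below: "\<And>h x. cmod h < \<rho> \<Longrightarrow> \<epsilon> * norm x \<le> norm (B x + h *\<^sub>C x)"
  shows "\<exists>e>\<epsilon>. \<forall>x. e * norm x \<le> norm (B x)"
proof -
  obtain K where K: "K > 0" "\<And>x. norm (B x) \<le> K * norm x"
    using bounded_linear.pos_bounded[OF bounded_clinearD(1)[OF B]] by (auto simp: mult.commute)
  \<comment> \<open>The bounds serve in turn to stay inside the disc where \<open>below\<close>
    applies, to get \<open>s \<le> 1\<close>, and to push the cubic error below half of the
    gain.\<close>
  define r where "r = min (\<rho> / 2) (min K (\<epsilon> ^ 3 / (6 * K\<^sup>2)))"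
  have r: "r > 0" "r < \<rho>" "r \<le> K" "r \<le> \<epsilon> ^ 3 / (6 * K\<^sup>2)"
    using K(1) \<open>\<epsilon> > 0\<close> \<open>\<rho> > 0\<close> by (auto simp: r_def)
  \<comment> \<open>The relative gain: as \<open>norm a\<close> is at most
    \<open>K * norm b\<close>, the term \<open>r\<^sup>2 * (norm b)\<^sup>2\<close> is at least
    \<open>s * (norm a)\<^sup>2\<close>.\<close>
  define s where "s = r\<^sup>2 / K\<^sup>2"
  have s: "0 < s" "s \<le> 1"
    using r K(1) by (auto simp: s_def power_mono)
  have cube: "r ^ 3 / \<epsilon>\<^sup>2 \<le> \<epsilon> * s / 6"
  proof -
    have "r ^ 3 / \<epsilon>\<^sup>2 = r\<^sup>2 * r / \<epsilon>\<^sup>2" by (simp add: power3_eq_cube power2_eq_square)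
    also have "\<dots> \<le> r\<^sup>2 * (\<epsilon> ^ 3 / (6 * K\<^sup>2)) / \<epsilon>\<^sup>2"
      by (intro divide_right_mono mult_left_mono r) auto
    also have "\<dots> = \<epsilon> * s / 6"
      using \<open>\<epsilon> > 0\<close> K(1) by (simp add: s_def field_simps power3_eq_cube power2_eq_square)
    finally show ?thesis .
  qed
  have "(\<epsilon> + \<epsilon> * s / 6) * norm a \<le> norm (B a)" for a
  proof -
    obtain b where b: "B b = a" using surj by (metis surjD)
    obtain c where c: "B c = b" using surj by (metis surjD)
    have B_below: "\<epsilon> * norm x \<le> norm (B x)" for x
      using below[of 0 x] \<open>\<rho> > 0\<close> by simp
    have nc: "r ^ 3 * norm c \<le> r ^ 3 / \<epsilon>\<^sup>2 * norm a"
    proof -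
      have "\<epsilon>\<^sup>2 * norm c \<le> \<epsilon> * norm b"
        using B_below[of c] c \<open>\<epsilon> > 0\<close> by (simp add: power2_eq_square mult_left_mono)
      also have "\<dots> \<le> norm a" using B_below[of b] b by simp
      finally have "norm c \<le> norm a / \<epsilon>\<^sup>2" using \<open>\<epsilon> > 0\<close> by (simp add: field_simps)
      then show ?thesis using r(1) mult_left_mono[of "norm c" "norm a / \<epsilon>\<^sup>2" "r ^ 3"] by simp
    qed
    have nb: "s * (norm a)\<^sup>2 \<le> r\<^sup>2 * (norm b)\<^sup>2"
    proof -
      have "(norm a)\<^sup>2 \<le> (K * norm b)\<^sup>2" using K(2)[of b] b by (intro power_mono) auto
      then have "r\<^sup>2 * (norm a)\<^sup>2 \<le> r\<^sup>2 * (K * norm b)\<^sup>2"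
        by (intro mult_left_mono) auto
      then show ?thesis using K(1) by (simp add: s_def field_simps power_mult_distrib)
    qed
    define v where "v h = a - h *\<^sub>C b + h\<^sup>2 *\<^sub>C c" for h
    define R where "R = norm (B a) + r ^ 3 * norm c"
    have "R \<ge> 0" using r(1) by (simp add: R_def)
    have v_le: "\<epsilon>\<^sup>2 * (norm (v h))\<^sup>2 \<le> R\<^sup>2" if "cmod h = r" for h
    proof -
      have "B (v h) + h *\<^sub>C v h = B a + h ^ 3 *\<^sub>C c"
        by (simp add: v_def bounded_clinearD(2-4)[OF B] b c cscale_diff_right cscale_add_right
            cscale_cscale power3_eq_cube power2_eq_square mult.assoc)
      then have "\<epsilon> * norm (v h) \<le> norm (B a + h ^ 3 *\<^sub>C c)"
        using below[of h "v h"] that r(2) by simp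
      also have "\<dots> \<le> R"
        unfolding R_def using norm_triangle_ineq[of "B a" "h ^ 3 *\<^sub>C c"] that
        by (simp add: norm_cscale norm_power)
      finally show ?thesis
        using \<open>\<epsilon> > 0\<close> by (simp add: power_mono flip: power_mult_distrib)
    qed
    have par: "(norm (x + y))\<^sup>2 + (norm (x - y))\<^sup>2 = 2 * (norm x)\<^sup>2 + 2 * (norm y)\<^sup>2" for x y :: ell2
      by (simp add: power2_norm_eq_inner inner_add_left inner_add_right inner_diff_left
          inner_diff_right inner_commute)
    \<comment> \<open>The four points are r, -r, ir and -ir. By the parallelogram law opposite
      points cancel the cross terms with \<open>b\<close>. The square of \<open>h\<close> has
      opposite signs for the two pairs, so adding them cancels the cross term of \<open>a\<close>
      and \<open>c\<close>.\<close>
    define r' where "r' = complex_of_real r"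
    have "(norm (v r'))\<^sup>2 + (norm (v (- r')))\<^sup>2
        = 2 * (norm (a + r'\<^sup>2 *\<^sub>C c))\<^sup>2 + 2 * (r * norm b)\<^sup>2"
      using par[of "a + r'\<^sup>2 *\<^sub>C c" "r' *\<^sub>C b"] r(1)
      by (simp add: v_def cscale_minus_left norm_cscale algebra_simps r'_def)
    moreover have "(norm (v (\<i> * r')))\<^sup>2 + (norm (v (- (\<i> * r'))))\<^sup>2
        = 2 * (norm (a - r'\<^sup>2 *\<^sub>C c))\<^sup>2 + 2 * (r * norm b)\<^sup>2"
      using par[of "a - r'\<^sup>2 *\<^sub>C c" "(\<i> * r') *\<^sub>C b"] r(1)
      by (simp add: v_def cscale_minus_left norm_cscale algebra_simps r'_def norm_mult power_mult_distrib)
    moreover note par[of a "r'\<^sup>2 *\<^sub>C c"]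
    ultimately have "4 * (norm a)\<^sup>2 + 4 * (r * norm b)\<^sup>2
        \<le> (norm (v r'))\<^sup>2 + (norm (v (- r')))\<^sup>2
          + ((norm (v (\<i> * r')))\<^sup>2 + (norm (v (- (\<i> * r'))))\<^sup>2)"
      using zero_le_power2[of "norm (r'\<^sup>2 *\<^sub>C c)"] by linarith
    then have "\<epsilon>\<^sup>2 * (4 * (norm a)\<^sup>2 + 4 * (r * norm b)\<^sup>2)
        \<le> \<epsilon>\<^sup>2 * ((norm (v r'))\<^sup>2 + (norm (v (- r')))\<^sup>2
          + ((norm (v (\<i> * r')))\<^sup>2 + (norm (v (- (\<i> * r'))))\<^sup>2))"
      by (intro mult_left_mono) auto
    also have "\<dots> \<le> 4 * R\<^sup>2"
      using v_le[of r'] v_le[of "- r'"] v_le[of "\<i> * r'"] v_le[of "- (\<i> * r')"] r(1)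
      by (simp add: r'_def norm_mult distrib_left)
    finally have "\<epsilon>\<^sup>2 * ((norm a)\<^sup>2 + r\<^sup>2 * (norm b)\<^sup>2) \<le> R\<^sup>2"
      by (simp add: power_mult_distrib algebra_simps)
    moreover have "(\<epsilon> * (1 + s / 3) * norm a)\<^sup>2 \<le> \<epsilon>\<^sup>2 * ((norm a)\<^sup>2 + r\<^sup>2 * (norm b)\<^sup>2)"
    proof -
      have eq: "(1 + s / 3)\<^sup>2 = 1 + s - (s - s * s) / 9 - 2 * s / 9"
        by (simp add: power2_eq_square field_simps)
      have "1 + s - (s - u) / 9 - 2 * s / 9 \<le> 1 + s" if "u \<le> s" for u
        using s that by (simp add: diff_divide_distrib)
      from this[of "s * s"] have "(1 + s / 3)\<^sup>2 \<le> 1 + s"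
        using s by (simp only: eq mult_left_le less_imp_le)
      then have "(1 + s / 3)\<^sup>2 * (norm a)\<^sup>2 \<le> (1 + s) * (norm a)\<^sup>2"
        by (intro mult_right_mono) auto
      also have "\<dots> \<le> (norm a)\<^sup>2 + r\<^sup>2 * (norm b)\<^sup>2"
        using nb by (simp add: algebra_simps)
      finally have "\<epsilon>\<^sup>2 * ((1 + s / 3)\<^sup>2 * (norm a)\<^sup>2) \<le> \<epsilon>\<^sup>2 * ((norm a)\<^sup>2 + r\<^sup>2 * (norm b)\<^sup>2)"
        by (intro mult_left_mono) auto
      then show ?thesis by (simp add: power_mult_distrib mult.assoc)
    qed
    ultimately have "\<epsilon> * (1 + s / 3) * norm a \<le> R"
      using \<open>R \<ge> 0\<close> by (meson order_trans power2_le_imp_le)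
    \<comment> \<open>The gain is \<open>\<epsilon> * s / 3\<close> and the error at most
      \<open>\<epsilon> * s / 6\<close>, so half of the gain is left.\<close>
    then have "\<epsilon> * (1 + s / 3) * norm a \<le> norm (B a) + \<epsilon> * s / 6 * norm a"
      using order_trans[OF nc mult_right_mono[OF cube]] by (simp add: R_def)
    then show ?thesis by (simp add: algebra_simps)
  qed
  then show ?thesis
    using s(1) \<open>\<epsilon> > 0\<close> by (intro exI[of _ "\<epsilon> + \<epsilon> * s / 6"]) auto
qed

section \<open>Spectra of self-adjoint operators\<close>

text \<open>Lets the chosen adjoint be replaced by its explicit formula, since the two agree only on
  \<open>V\<close>. Note that \<open>inv_into V\<close> depends only on values on
  \<open>V\<close>.\<close>

lemma spectrum_on_cong:
  assumes "\<And>x. x \<in> V \<Longrightarrow> A x = B x"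
  shows "spectrum_on V A = spectrum_on V B"
proof -
  have "invertible_on V (resolvent_op z A) = invertible_on V (resolvent_op z B)" for z
  proof -
    have eq: "resolvent_op z A x = resolvent_op z B x" if "x \<in> V" for x
      using assms that by (simp add: resolvent_op_def)
    then have "bij_betw (resolvent_op z A) V V = bij_betw (resolvent_op z B) V V"
      by (rule bij_betw_cong)
    moreover have "inv_into V (resolvent_op z A) = inv_into V (resolvent_op z B)"
      unfolding inv_into_def using eq by (auto intro!: ext arg_cong[where f = Eps])
    ultimately show ?thesis by (simp add: invertible_on_def)
  qed
  then show ?thesis by (simp add: spectrum_on_def)
qed

lemma adjoint_pair_resolvent_op:
  assumes "adjoint_pair A B"
  shows "adjoint_pair (resolvent_op z A) (resolvent_op (cnj z) B)"
  unfolding resolvent_op_def by (intro adjoint_pair_diff adjoint_pair_cscale assms)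

context
  fixes H :: "ell2 \<Rightarrow> ell2" and V :: "ell2 set"
  assumes H: "adjoint_pair H H" and V: "ell2.subspace V" "complete V" "H ` V \<subseteq> V"
begin

lemma bounded_clinear_selfadjoint: "bounded_clinear H"
  using H by (simp add: adjoint_pair_def)

text \<open>For real \<open>\<mu>\<close> the resolvent operator is its own adjoint, so a lower
  bound brings surjectivity with it.\<close>

lemma selfadjoint_notin_spectrum_on_iff:
  "complex_of_real \<mu> \<notin> spectrum_on V H \<longleftrightarrow>
    (\<exists>c>0. \<forall>x\<in>V. c * norm x \<le> norm (resolvent_op (complex_of_real \<mu>) H x))"
proof -
  let ?B = "resolvent_op (complex_of_real \<mu>) H"
  have B: "adjoint_pair ?B ?B" "?B ` V \<subseteq> V"
    using adjoint_pair_resolvent_op[OF H, of "complex_of_real \<mu>"] V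
    by (auto simp: resolvent_op_image_subset)
  have "invertible_on V ?B \<longleftrightarrow>
      V \<subseteq> ?B ` V \<and> (\<exists>c>0. \<forall>x\<in>V. c * norm x \<le> norm (?B x))"
    using B by (intro invertible_on_iff V) (simp_all add: adjoint_pair_def)
  moreover have "V \<subseteq> ?B ` V" if "c > 0" "\<forall>x\<in>V. c * norm x \<le> norm (?B x)" for c
    by (rule adjoint_bounded_below_imp_surj[OF B(1) V(1,2) B(2) B(2) that(1)]) (use that in blast)
  ultimately show ?thesis
    unfolding spectrum_on_def by blast
qed

text \<open>The parts of \<open>z - H\<close> coming from the real and from the imaginary part of
  \<open>z\<close> map \<open>x\<close> to orthogonal vectors for the real inner product, so
  Pythagoras gives the lower bound \<open>\<bar>Im z\<bar>\<close>. The same bound for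
  \<open>cnj z\<close> gives surjectivity.\<close>

lemma selfadjoint_spectrum_on_real:
  assumes "z \<in> spectrum_on V H"
  shows "Im z = 0"
proof (rule ccontr)
  assume im: "Im z \<noteq> 0"
  let ?B = "\<lambda>z. resolvent_op z H"
  have below: "\<bar>Im z\<bar> * norm x \<le> norm (?B z x)" for z x
  proof -
    let ?u = "resolvent_op (complex_of_real (Re z)) H x"
    have eq: "?B z x = ?u + Im z *\<^sub>R \<i> *\<^sub>C x"
    proof -
      have "z *\<^sub>C x = complex_of_real (Re z) *\<^sub>C x + Im z *\<^sub>R \<i> *\<^sub>C x"
        by (subst complex_eq[of z])
          (simp add: scaleR_eq_cscale cscale_cscale cscale_add_left mult.commute)
      then show ?thesis by (simp add: resolvent_op_def)
    qed
    have "inner (H x) (\<i> *\<^sub>C x) = 0"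
    proof -
      have "inner (H x) (\<i> *\<^sub>C x) = inner x (\<i> *\<^sub>C H x)"
        by (simp add: adjoint_pair_inner[OF H] bounded_clinearD(2)[OF bounded_clinear_selfadjoint])
      also have "\<dots> = - inner (\<i> *\<^sub>C x) (H x)"
        by (simp add: inner_cscale_left cscale_minus_left)
      finally show ?thesis by (simp add: inner_commute)
    qed
    then have "inner ?u (\<i> *\<^sub>C x) = 0"
      using inner_ii_self[of x]
      by (simp add: resolvent_op_def inner_diff_left inner_diff_right inner_commute[of "\<i> *\<^sub>C x"] flip: scaleR_eq_cscale)
    then have "(norm (?B z x))\<^sup>2 = (norm ?u)\<^sup>2 + (Im z)\<^sup>2 * (norm x)\<^sup>2"
      unfolding eq
      by (subst norm_add_Pythagorean) (simp_all add: orthogonal_def norm_cscale power_mult_distrib)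
    then have "(\<bar>Im z\<bar> * norm x)\<^sup>2 \<le> (norm (?B z x))\<^sup>2"
      by (simp add: power_mult_distrib)
    then show ?thesis by (rule power2_le_imp_le) simp
  qed
  note img = resolvent_op_image_subset[OF V(1,3)]
  have "V \<subseteq> ?B z ` V"
    by (rule adjoint_bounded_below_imp_surj[OF adjoint_pair_resolvent_op[OF H] V(1,2) img img])
      (use im below[of "cnj z"] in auto)
  then have "invertible_on V (?B z)"
    using invertible_on_iff[OF bounded_clinear_resolvent_op V(1) img] bounded_clinear_selfadjoint
      im below[of z] by (metis zero_less_abs_iff)
  then show False using assms by (simp add: spectrum_on_def)
qed

lemma positive_spectrum_on_nonneg:
  assumes pos: "\<And>x. x \<in> V \<Longrightarrow> 0 \<le> inner (H x) x" and "z \<in> spectrum_on V H"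
  shows "\<exists>\<mu>\<ge>0. z = complex_of_real \<mu>"
proof -
  obtain \<mu> where z: "z = complex_of_real \<mu>"
    using selfadjoint_spectrum_on_real[OF assms(2)] by (metis complex_is_Real_iff Reals_cases)
  have "\<mu> \<ge> 0"
  proof (rule ccontr)
    assume "\<not> \<mu> \<ge> 0"
    have "- \<mu> * norm x \<le> norm (resolvent_op (complex_of_real \<mu>) H x)" if "x \<in> V" for x
    proof (cases "x = 0")
      case False
      have "- \<mu> * (norm x * norm x) \<le> inner (- resolvent_op (complex_of_real \<mu>) H x) x"
        using pos[OF that]
        by (simp add: resolvent_op_def inner_diff_left power2_norm_eq_inner
            flip: scaleR_eq_cscale power2_eq_square)
      also have "\<dots> \<le> norm (resolvent_op (complex_of_real \<mu>) H x) * norm x"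
        using norm_cauchy_schwarz[of "- resolvent_op (complex_of_real \<mu>) H x" x] by simp
      finally show ?thesis
        unfolding mult.assoc[symmetric] by (rule mult_right_le_imp_le) (use False in simp)
    qed simp
    then show False
      using assms(2) \<open>\<not> \<mu> \<ge> 0\<close> unfolding z
      by (metis neg_0_less_iff_less not_le selfadjoint_notin_spectrum_on_iff)
  qed
  then show ?thesis using z by blast
qed

text \<open>If \<open>c\<close> is the largest lower bound of a self-adjoint \<open>B\<close> then \<open>B\<^sup>2 - c\<^sup>2\<close> is positive and not
  bounded below, and it factors as \<open>(B - c) (B + c)\<close>. Hence \<open>c\<close> or \<open>- c\<close> is in the spectrum of
  \<open>B\<close>.\<close>

lemma selfadjoint_spectral_gap:
  assumes gap: "\<And>\<mu>. \<bar>\<mu> - \<nu>\<bar> < d \<Longrightarrow> complex_of_real \<mu> \<notin> spectrum_on V H" and "x \<in> V"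
  shows "d * norm x \<le> norm (resolvent_op (complex_of_real \<nu>) H x)"
proof (cases "x = 0")
  case False
  define B where "B = resolvent_op (complex_of_real \<nu>) H"
  have BB: "adjoint_pair B B" and BV: "B ` V \<subseteq> V"
    using adjoint_pair_resolvent_op[OF H, of "complex_of_real \<nu>"] V
    by (auto simp: B_def resolvent_op_image_subset)
  have B: "bounded_clinear B" using BB by (simp add: adjoint_pair_def)
  define c where "c = (INF x\<in>V - {0}. norm (B x) / norm x)"
  have c_le: "c * norm y \<le> norm (B y)" if "y \<in> V" for y
  proof (cases "y = 0")
    case False
    have "c \<le> norm (B y) / norm y"
      unfolding c_def using that False by (intro cINF_lower) (auto intro!: bdd_belowI2[of _ 0])
    then show ?thesis using False by (simp add: field_simps)
  qed simp
  have c0: "c \<ge> 0"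
    unfolding c_def using False assms(2) by (intro cINF_greatest) auto
  show ?thesis
  proof (cases "d \<le> c")
    case True
    then have "d * norm x \<le> c * norm x" by (intro mult_right_mono) auto
    then show ?thesis using c_le[OF assms(2)] by (simp add: B_def)
  next
    case d: False
    have shift: "resolvent_op (complex_of_real (\<nu> - t)) H y = B y - t *\<^sub>R y" for t y
      by (simp add: B_def resolvent_op_def scaleR_eq_cscale cscale_diff_left)
    have "complex_of_real (\<nu> - c) \<notin> spectrum_on V H" "complex_of_real (\<nu> - (- c)) \<notin> spectrum_on V H"
      using d c0 by (intro gap; simp)+
    then obtain e1 e2 where e: "e1 > 0" "e2 > 0"
      and e1: "\<And>y. y \<in> V \<Longrightarrow> e1 * norm y \<le> norm (B y - c *\<^sub>R y)"
      and e2: "\<And>y. y \<in> V \<Longrightarrow> e2 * norm y \<le> norm (B y + c *\<^sub>R y)"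
      unfolding selfadjoint_notin_spectrum_on_iff shift by auto
    define G where "G y = B (B y) - c\<^sup>2 *\<^sub>R y" for y
    have GG: "adjoint_pair G G"
      using adjoint_pair_diff[OF adjoint_pair_compose[OF BB BB]
          adjoint_pair_cscale[of "complex_of_real (c\<^sup>2)"]]
      unfolding G_def[abs_def] scaleR_eq_cscale by simp
    have GV: "G ` V \<subseteq> V"
      using BV V by (auto simp: G_def scaleR_eq_cscale intro!: ell2.subspace_diff ell2.subspace_scale)
    have G: "bounded_clinear G" using GG by (simp add: adjoint_pair_def)
    obtain K where K: "K > 0" "\<And>x. norm (G x) \<le> K * norm x"
      using bounded_linear.pos_bounded[OF bounded_clinearD(1)[OF G]] by (auto simp: mult.commute)
    have G_inner: "inner (G y) y = (norm (B y))\<^sup>2 - c\<^sup>2 * (norm y)\<^sup>2" for y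
      by (simp add: G_def inner_diff_left adjoint_pair_inner[OF BB] power2_norm_eq_inner)
    have G_pos: "0 \<le> inner (G y) y" if "y \<in> V" for y
      using power_mono[OF c_le[OF that], of 2] c0 by (simp add: G_inner power_mult_distrib)
    \<comment> \<open>The Cauchy-Schwarz inequality for the positive form of \<open>G\<close>,
      obtained from positivity at \<open>y - t *\<^sub>R G y\<close> with
      \<open>t = 1 / K\<close>.\<close>
    have G_le: "(norm (G y))\<^sup>2 \<le> K * inner (G y) y" if "y \<in> V" for y
    proof -
      define t where "t = 1 / K"
      have "y - t *\<^sub>R G y \<in> V"
        using that GV V by (auto simp: scaleR_eq_cscale intro!: ell2.subspace_diff ell2.subspace_scale)
      from G_pos[OF this]
      have "0 \<le> inner (G y) y - 2 * t * (norm (G y))\<^sup>2 + t\<^sup>2 * inner (G (G y)) (G y)"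
        by (simp add: bounded_clinearD(4,7)[OF G] inner_diff_left inner_diff_right power2_eq_square
            adjoint_pair_inner[OF GG] power2_norm_eq_inner[unfolded power2_eq_square] algebra_simps)
      also have "inner (G (G y)) (G y) \<le> K * (norm (G y))\<^sup>2"
        using norm_cauchy_schwarz[of "G (G y)" "G y"] mult_right_mono[OF K(2)[of "G y"], of "norm (G y)"]
        by (simp add: power2_eq_square)
      finally have "0 \<le> inner (G y) y - 2 * t * (norm (G y))\<^sup>2 + t\<^sup>2 * (K * (norm (G y))\<^sup>2)"
        by (simp add: mult_left_mono)
      then show ?thesis using K(1) by (simp add: t_def power2_eq_square field_simps)
    qed
    \<comment> \<open>If both factors \<open>B - c\<close> and \<open>B + c\<close> are bounded
      below, so is \<open>G\<close>, and \<open>G_le\<close> turns this into a lower bound for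
      \<open>B\<close> that exceeds \<open>c\<close>, contradicting the choice of \<open>c\<close>
      as an infimum.\<close>
    have "sqrt (c\<^sup>2 + (e1 * e2)\<^sup>2 / K) * norm y \<le> norm (B y)" if y: "y \<in> V" for y
    proof -
      let ?w = "B y + c *\<^sub>R y"
      have "?w \<in> V"
        using y BV V by (auto simp: scaleR_eq_cscale intro!: ell2.subspace_add ell2.subspace_scale)
      then have "e1 * norm ?w \<le> norm (B ?w - c *\<^sub>R ?w)" by (rule e1)
      moreover have "B ?w - c *\<^sub>R ?w = G y"
        by (simp add: G_def bounded_clinearD(3,7)[OF B] power2_eq_square algebra_simps)
      ultimately have "e1 * e2 * norm y \<le> norm (G y)"
        using order_trans[OF mult_left_mono[OF e2[OF y], of e1]] e by (simp add: mult.assoc)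
      then have "(e1 * e2 * norm y)\<^sup>2 \<le> K * inner (G y) y"
        by (rule order_trans[OF power_mono G_le[OF y]]) (use e in simp)
      then have "(c\<^sup>2 + (e1 * e2)\<^sup>2 / K) * (norm y)\<^sup>2 \<le> (norm (B y))\<^sup>2"
        using K(1) by (simp add: G_inner field_simps power_mult_distrib)
      then have "(sqrt (c\<^sup>2 + (e1 * e2)\<^sup>2 / K) * norm y)\<^sup>2 \<le> (norm (B y))\<^sup>2"
        using K(1) by (simp add: power_mult_distrib)
      then show ?thesis by (rule power2_le_imp_le) simp
    qed
    then have "sqrt (c\<^sup>2 + (e1 * e2)\<^sup>2 / K) \<le> c"
      unfolding c_def[symmetric] using False assms(2)
      by (subst c_def, intro cINF_greatest) (auto simp: field_simps)
    then have "c\<^sup>2 + (e1 * e2)\<^sup>2 / K \<le> c\<^sup>2"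
      by (rule sqrt_le_D)
    then show ?thesis using e K(1) by (simp add: divide_le_0_iff)
  qed
qed simp

end

section \<open>Truncation to finitely many coordinates\<close>

text \<open>The bound is inclusive: counting from 0, the last basis vector kept is
  \<open>\<delta> n\<close>, and it is the one that a weighted shift moves out of the range, with
  weight \<open>\<alpha> n\<close>.\<close>

definition trunc :: "nat \<Rightarrow> ell2 \<Rightarrow> ell2"
  where "trunc n = mult_op (\<lambda>k. if k \<le> n then 1 else 0)"

lemma bounded_range_initial: "bounded (range (\<lambda>k. if k \<le> n then 1 else 0 :: complex))"
  by (auto simp: bounded_iff intro!: exI[of _ 1])

lemma coord_trunc: "coord (trunc n x) k = (if k \<le> n then coord x k else 0)"
  by (simp add: trunc_def coord_mult_op[OF bounded_range_initial])

lemma trunc_trunc [simp]: "trunc n (trunc n x) = trunc n x"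
  by (rule ell2_eqI) (simp add: coord_trunc)

lemma range_trunc_iff: "x \<in> range (trunc n) \<longleftrightarrow> trunc n x = x"
  by (metis rangeE rangeI trunc_trunc)

lemma adjoint_pair_trunc: "adjoint_pair (trunc n) (trunc n)"
proof -
  have "(\<lambda>k. cnj (if k \<le> n then 1 else 0)) = (\<lambda>k. if k \<le> n then 1 else 0)"
    by auto
  then show ?thesis
    using adjoint_pair_mult_op[OF bounded_range_initial, of n] by (simp add: trunc_def)
qed

lemma bounded_clinear_trunc: "bounded_clinear (trunc n)"
  using adjoint_pair_trunc by (simp add: adjoint_pair_def)

lemma norm_trunc_le: "norm (trunc n x) \<le> norm x"
  unfolding trunc_def using mult_op_norm_le[OF bounded_range_initial, of n 1 x] by simp

lemma norm_trunc_Pythagorean: "(norm (x - trunc n x))\<^sup>2 + (norm (trunc n x))\<^sup>2 = (norm x)\<^sup>2"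
proof -
  have "inner (x - trunc n x) (trunc n x) = 0"
    using adjoint_pair_inner[OF adjoint_pair_trunc, of n x "trunc n x"]
    by (simp add: inner_diff_left adjoint_pair_inner[OF adjoint_pair_trunc])
  then show ?thesis
    using norm_add_Pythagorean[of "x - trunc n x" "trunc n x"] by (simp add: orthogonal_def)
qed

text \<open>The squared norms of the truncations are partial sums of the squared norm of
  \<open>x\<close>; Pythagoras turns their convergence into that of the vectors.\<close>

lemma tendsto_trunc:
  assumes "filterlim n at_top F"
  shows "((\<lambda>k. trunc (n k) x) \<longlongrightarrow> x) F"
proof -
  have "(norm (trunc N x))\<^sup>2 = (\<Sum>k\<le>N. (cmod (coord x k))\<^sup>2)" for N
  proof -
    have "(\<Sum>k. (cmod (coord (trunc N x) k))\<^sup>2) = (\<Sum>k\<le>N. (cmod (coord (trunc N x) k))\<^sup>2)"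
      by (rule suminf_finite) (auto simp: coord_trunc)
    then show ?thesis
      by (simp add: norm_ell2 coord_trunc sum_nonneg del: real_sqrt_pow2_iff)
  qed
  then have "(\<lambda>N. (norm (trunc N x))\<^sup>2) \<longlonglongrightarrow> (norm x)\<^sup>2"
    using summable_LIMSEQ'[OF coord_summable, of x]
    by (simp add: norm_ell2[of x] suminf_nonneg[OF coord_summable])
  then have "(\<lambda>N. (norm x)\<^sup>2 - (norm (trunc N x))\<^sup>2) \<longlonglongrightarrow> (norm x)\<^sup>2 - (norm x)\<^sup>2"
    by (rule tendsto_diff[OF tendsto_const])
  moreover have "(norm (trunc N x - x))\<^sup>2 = (norm x)\<^sup>2 - (norm (trunc N x))\<^sup>2" for N
    using norm_trunc_Pythagorean[of x N] by (simp add: norm_minus_commute)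
  ultimately have "(\<lambda>N. (norm (trunc N x - x))\<^sup>2) \<longlonglongrightarrow> 0"
    by (simp only: diff_self)
  then have "(\<lambda>N. trunc N x) \<longlonglongrightarrow> x"
    by (simp add: LIM_zero_iff tendsto_norm_zero_iff)
  then show ?thesis
    using assms by (rule filterlim_compose)
qed

lemma trunc_eq_sum: "trunc n x = (\<Sum>k\<le>n. coord x k *\<^sub>C \<delta> k)"
  by (rule ell2_eqI)
    (simp add: coord_sum coord_cscale coord_ebasis coord_trunc if_distrib cong: if_cong)

lemma subspace_range_trunc: "ell2.subspace (range (trunc n))"
proof -
  have "range (trunc n) = {x. trunc n x = x}"
    using range_trunc_iff by blast
  then show ?thesis
    by (simp add: ell2.subspace_def bounded_clinearD(2,3,6)[OF bounded_clinear_trunc])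
qed

lemma complete_range_trunc: "complete (range (trunc n))"
proof -
  have "range (trunc n) = {x. trunc n x = x}"
    using range_trunc_iff by blast
  moreover have "continuous_on UNIV (trunc n)"
    by (intro linear_continuous_on bounded_clinearD(1)[OF bounded_clinear_trunc])
  ultimately show ?thesis
    by (simp add: complete_eq_closed closed_Collect_eq)
qed

lemma cspan_ebasis: "cspan (\<delta> ` {..n}) = range (trunc n)"
proof
  show "cspan (\<delta> ` {..n}) \<subseteq> range (trunc n)"
  proof (rule ell2.span_minimal[OF _ subspace_range_trunc])
    have "trunc n (\<delta> k) = \<delta> k" if "k \<le> n" for k
      using that by (intro ell2_eqI) (simp add: coord_trunc coord_ebasis)
    then show "\<delta> ` {..n} \<subseteq> range (trunc n)" by (auto simp: range_trunc_iff)
  qed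
  have "(\<Sum>k\<le>n. coord x k *\<^sub>C \<delta> k) \<in> cspan (\<delta> ` {..n})" for x
    by (intro ell2.span_sum ell2.span_scale ell2.span_base) simp
  then show "range (trunc n) \<subseteq> cspan (\<delta> ` {..n})"
    by (auto simp: trunc_eq_sum)
qed

lemma orth_proj_range_trunc: "orth_proj (range (trunc n)) = trunc n"
proof
  fix x
  have orth: "inner (x - trunc n x) w = 0" if "w \<in> range (trunc n)" for w
  proof -
    have "inner (x - trunc n x) (trunc n w) = inner (trunc n (x - trunc n x)) w"
      by (rule adjoint_pair_inner[OF adjoint_pair_trunc, symmetric])
    then show ?thesis
      using that by (simp add: range_trunc_iff bounded_clinearD(4)[OF bounded_clinear_trunc])
  qed
  show "orth_proj (range (trunc n)) x = trunc n x"
    unfolding orth_proj_def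
  proof (rule the_equality)
    \<comment> \<open>Orthogonality for \<open>cinner\<close> follows from the real one, because the
      range contains \<open>\<i> *\<^sub>C w\<close> along with \<open>w\<close>.\<close>
    show "trunc n x \<in> range (trunc n) \<and> (\<forall>w\<in>range (trunc n). cinner (x - trunc n x) w = 0)"
      by (auto simp: cinner_eq orth ell2.subspace_scale[OF subspace_range_trunc]
          complex_eq_iff)
  next
    fix v assume v: "v \<in> range (trunc n) \<and> (\<forall>w\<in>range (trunc n). cinner (x - v) w = 0)"
    then have w: "v - trunc n x \<in> range (trunc n)"
      by (intro ell2.subspace_diff subspace_range_trunc) auto
    then have "inner (x - v) (v - trunc n x) = 0"
      using v by (auto simp: cinner_eq complex_eq_iff)
    then have "inner (v - trunc n x) (v - trunc n x) = 0"
      using orth[OF w] by (simp add: inner_diff_left)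
    then show "v = trunc n x" by simp
  qed
qed

text \<open>Finite dimension enters here. Counting independent vectors gives surjectivity; preimages
  of the basis vectors then give an explicit bound for the inverse.\<close>

lemma injective_on_range_trunc:
  assumes B: "bounded_clinear B" and BV: "B ` range (trunc n) \<subseteq> range (trunc n)"
    and ker: "\<And>x. x \<in> range (trunc n) \<Longrightarrow> B x = 0 \<Longrightarrow> x = 0"
  shows "range (trunc n) \<subseteq> B ` range (trunc n)"
    and "\<exists>c>0. \<forall>x\<in>range (trunc n). c * norm x \<le> norm (B x)"
proof -
  let ?V = "range (trunc n)"
  note sub = subspace_range_trunc[of n]
  interpret vector_space_pair cscale cscale by unfold_locales
  have lin: "Vector_Spaces.linear cscale cscale B"
    unfolding Vector_Spaces.linear_iff
    using bounded_clinearD(2,3)[OF B] ell2.vector_space_axioms by blast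
  have inj: "inj_on B ?V"
  proof (rule inj_onI)
    fix x y assume xy: "x \<in> ?V" "y \<in> ?V" "B x = B y"
    have "B (x - y) = 0" using xy(3) by (simp only: bounded_clinearD(4)[OF B] diff_self)
    with ell2.subspace_diff[OF sub xy(1,2)] have "x - y = 0" by (rule ker)
    then show "x = y" by simp
  qed
  \<comment> \<open>An independent spanning subset serves as a basis, without a separate proof that
    the basis vectors are independent.\<close>
  obtain F where F: "F \<subseteq> \<delta> ` {..n}" "\<not> ell2.dependent F" "\<delta> ` {..n} \<subseteq> cspan F"
    by (rule ell2.maximal_independent_subset)
  have span: "cspan F = ?V"
    unfolding cspan_ebasis[symmetric]
    by (intro equalityI ell2.span_mono F(1) ell2.span_minimal F(3) ell2.subspace_span)
  have fin: "finite F" using F(1) finite_subset by blast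
  have indep: "\<not> ell2.dependent (B ` F)"
    using linear_independent_injective_image[OF lin F(2)] inj span by simp
  have BF: "B ` F \<subseteq> cspan F"
    using BV ell2.span_superset[of F] span by blast
  have card: "card (B ` F) = card F"
    using inj_on_subset[OF inj] ell2.span_superset[of F] span by (intro card_image) auto
  have "F \<subseteq> cspan (B ` F)"
  proof
    fix v assume v: "v \<in> F"
    show "v \<in> cspan (B ` F)"
    proof (rule ccontr)
      assume not_in: "v \<notin> cspan (B ` F)"
      then have "\<not> ell2.dependent (insert v (B ` F))"
        using indep by (rule ell2.independent_insertI)
      then have "card (insert v (B ` F)) \<le> card F"
        using ell2.independent_span_bound[OF fin] BF v ell2.span_base by auto
      moreover have "v \<notin> B ` F" using not_in ell2.span_base by blast
      ultimately show False using fin card by simp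
    qed
  qed
  then have "?V \<subseteq> cspan (B ` F)"
    using span by (metis ell2.span_minimal ell2.subspace_span)
  then show surj: "?V \<subseteq> B ` ?V"
    using linear_span_image[OF lin, of F] span by simp
  have "\<exists>w\<in>?V. B w = \<delta> k" if "k \<le> n" for k
  proof -
    have "\<delta> k \<in> ?V"
      using that ell2.span_base[of "\<delta> k" "\<delta> ` {..n}"] unfolding cspan_ebasis by blast
    with surj have "\<delta> k \<in> B ` ?V" by (rule subsetD)
    then show ?thesis by (metis imageE)
  qed
  then obtain w where w: "\<And>k. k \<le> n \<Longrightarrow> w k \<in> ?V" "\<And>k. k \<le> n \<Longrightarrow> B (w k) = \<delta> k"
    by metis
  define C where "C = (\<Sum>k\<le>n. norm (w k)) + 1"
  have "C > 0" by (simp add: C_def add_nonneg_pos sum_nonneg)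
  have "norm u \<le> C * norm (B u)" if u: "u \<in> ?V" for u
  proof -
    let ?s = "\<Sum>k\<le>n. coord (B u) k *\<^sub>C w k"
    have "B ?s = (\<Sum>k\<le>n. coord (B u) k *\<^sub>C \<delta> k)"
      by (simp add: linear_sum[OF lin] bounded_clinearD(2)[OF B] w)
    also have "\<dots> = B u"
      using BV imageI[OF u, of B] unfolding trunc_eq_sum[symmetric] range_trunc_iff[symmetric] by blast
    finally have Bs: "B ?s = B u" .
    have "?s \<in> ?V"
      by (rule ell2.subspace_sum[OF sub], rule ell2.subspace_scale[OF sub], rule w(1)) simp
    from inj_onD[OF inj Bs this u] have "?s = u" .
    then have "norm u \<le> (\<Sum>k\<le>n. norm (coord (B u) k *\<^sub>C w k))"
      using norm_sum[of "\<lambda>k. coord (B u) k *\<^sub>C w k" "{..n}"] by simp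
    also have "\<dots> \<le> (\<Sum>k\<le>n. norm (B u) * norm (w k))"
      by (intro sum_mono) (simp add: norm_cscale mult_right_mono norm_coord_le)
    also have "\<dots> \<le> C * norm (B u)"
      by (simp add: C_def algebra_simps flip: sum_distrib_left)
    finally show ?thesis .
  qed
  then show "\<exists>c>0. \<forall>x\<in>?V. c * norm x \<le> norm (B x)"
    using \<open>C > 0\<close> by (intro exI[of _ "1 / C"]) (auto simp: field_simps)
qed

lemma bounded_below_on_range_trunc_imp_surj:
  assumes "bounded_clinear B" "B ` range (trunc n) \<subseteq> range (trunc n)" "e > 0"
    and "\<And>x. x \<in> range (trunc n) \<Longrightarrow> e * norm x \<le> norm (B x)"
  shows "range (trunc n) \<subseteq> B ` range (trunc n)"
proof (rule injective_on_range_trunc(1)[OF assms(1,2)])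
  fix x assume "x \<in> range (trunc n)" "B x = 0"
  then have "e * norm x \<le> 0" using assms(4)[of x] by simp
  then show "x = 0" using assms(3) by (simp add: mult_le_0_iff)
qed

section \<open>Hausdorff convergence\<close>

lemma set_tendstoI:
  assumes 1: "\<And>r::real. r > 0 \<Longrightarrow> \<forall>\<^sub>F k in sequentially. \<forall>x\<in>X k. \<exists>y\<in>Y. dist x y < r"
    and 2: "\<And>r::real. r > 0 \<Longrightarrow> \<forall>\<^sub>F k in sequentially. \<forall>y\<in>Y. \<exists>x\<in>X k. dist y x < r"
  shows "set_tendsto X Y"
  unfolding set_tendsto_def
proof (rule order_tendstoI)
  fix a :: ennreal assume "0 < a"
  \<comment> \<open>Suprema turn strict bounds into weak ones, so a value strictly below
    \<open>a\<close> is aimed at.\<close>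
  then obtain b where b: "0 < b" "b < a" using dense by blast
  then obtain r where r: "b = ennreal r" "r > 0"
    by (cases b) auto
  have le: "(SUP x\<in>A. INF y\<in>B. ennreal (dist x y)) \<le> b"
    if "\<forall>x\<in>A. \<exists>y\<in>B. dist x y < r" for A B :: "'a set"
  proof (rule SUP_least)
    fix x assume "x \<in> A"
    with that have "\<exists>y\<in>B. dist x y < r" by blast
    then obtain y where "y \<in> B" "dist x y < r" by blast
    then show "(INF y\<in>B. ennreal (dist x y)) \<le> b"
      unfolding r by (intro INF_lower2[of y]) (auto simp: ennreal_leI)
  qed
  show "\<forall>\<^sub>F k in sequentially. hausdorff_dist (X k) Y < a"
    using 1[OF r(2)] 2[OF r(2)]
  proof eventually_elim
    case (elim k)
    then have "hausdorff_dist (X k) Y \<le> b" unfolding hausdorff_dist_def by (intro max.boundedI le)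
    then show ?case using b by simp
  qed
qed simp

text \<open>Each point of \<open>K\<close> outside the neighbourhood of \<open>Y\<close> has a ball
  that the sets eventually avoid; finitely many such balls cover this compact remainder.\<close>

lemma eventually_subset_nbhd_of_compact:
  fixes X :: "nat \<Rightarrow> 'a::metric_space set"
  assumes K: "compact K" "\<And>k. X k \<subseteq> K"
    and away: "\<And>z. z \<notin> Y \<Longrightarrow> \<exists>\<rho>>0. \<forall>\<^sub>F k in sequentially. ball z \<rho> \<inter> X k = {}" and "r > 0"
  shows "\<forall>\<^sub>F k in sequentially. \<forall>x\<in>X k. \<exists>y\<in>Y. dist x y < r"
proof -
  let ?U = "\<Union>y\<in>Y. ball y r"
  have "\<forall>z\<in>K - ?U. \<exists>\<rho>>0. \<forall>\<^sub>F k in sequentially. ball z \<rho> \<inter> X k = {}"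
  proof
    fix z assume "z \<in> K - ?U"
    then have "z \<notin> Y" using centre_in_ball[of z r] \<open>r > 0\<close> by blast
    then show "\<exists>\<rho>>0. \<forall>\<^sub>F k in sequentially. ball z \<rho> \<inter> X k = {}" by (rule away)
  qed
  then obtain \<rho> where \<rho>: "\<And>z. z \<in> K - ?U \<Longrightarrow> \<rho> z > 0"
    "\<And>z. z \<in> K - ?U \<Longrightarrow> \<forall>\<^sub>F k in sequentially. ball z (\<rho> z) \<inter> X k = {}"
    by metis
  have "compact (K - ?U)" by (intro compact_diff K) auto
  moreover have "K - ?U \<subseteq> (\<Union>z\<in>K - ?U. ball z (\<rho> z))"
    using \<rho>(1) centre_in_ball by blast
  ultimately obtain C where C: "C \<subseteq> K - ?U" "finite C" "K - ?U \<subseteq> (\<Union>z\<in>C. ball z (\<rho> z))"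
    using compactE_image[of "K - ?U" "K - ?U" "\<lambda>z. ball z (\<rho> z)"] open_ball by metis
  have "\<forall>\<^sub>F k in sequentially. \<forall>z\<in>C. ball z (\<rho> z) \<inter> X k = {}"
    using C \<rho>(2) by (intro eventually_ball_finite) auto
  then show ?thesis
  proof eventually_elim
    case (elim k)
    show ?case
    proof
      fix x assume x: "x \<in> X k"
      then have "x \<in> ?U" using K(2)[of k] C(3) elim by blast
      then show "\<exists>y\<in>Y. dist x y < r" by (auto simp: dist_commute)
    qed
  qed
qed

text \<open>Approximating each point separately suffices: a finite net of mesh \<open>r / 2\<close>
  makes the threshold for \<open>k\<close> uniform.\<close>

lemma eventually_near_bounded:
  fixes Y :: "'a::heine_borel set"
  assumes "bounded Y" and near: "\<And>y r. y \<in> Y \<Longrightarrow> r > 0 \<Longrightarrow> \<forall>\<^sub>F k in sequentially. \<exists>x\<in>X k. dist y x < r"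
    and "r > 0"
  shows "\<forall>\<^sub>F k in sequentially. \<forall>y\<in>Y. \<exists>x\<in>X k. dist y x < r"
proof -
  have "compact (closure Y)" using assms(1) by (simp add: compact_closure)
  moreover have "closure Y \<subseteq> (\<Union>y\<in>Y. ball y (r/2))"
  proof
    fix z assume "z \<in> closure Y"
    then obtain y where "y \<in> Y" "dist y z < r/2"
      using \<open>r > 0\<close> unfolding closure_approachable by (meson half_gt_zero)
    then show "z \<in> (\<Union>y\<in>Y. ball y (r/2))" by auto
  qed
  ultimately obtain C where C: "C \<subseteq> Y" "finite C" "closure Y \<subseteq> (\<Union>y\<in>C. ball y (r/2))"
    using compactE_image[of "closure Y" Y "\<lambda>y. ball y (r/2)"] open_ball by metis
  have "\<forall>\<^sub>F k in sequentially. \<forall>y\<in>C. \<exists>x\<in>X k. dist y x < r/2"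
    using C near[of _ "r/2"] \<open>r > 0\<close> by (intro eventually_ball_finite) auto
  then show ?thesis
  proof eventually_elim
    case (elim k)
    show ?case
    proof
      fix y assume "y \<in> Y"
      then obtain y' where y': "y' \<in> C" "dist y' y < r/2" 
        using C(3) closure_subset[of Y] by (auto simp: subset_iff)
      then obtain x where "x \<in> X k" "dist y' x < r/2" using elim by blast
      moreover have "dist y x < r"
        using dist_triangle[of y x y'] y'(2) \<open>dist y' x < r/2\<close> by (simp add: dist_commute)
      ultimately show "\<exists>x\<in>X k. dist y x < r" by blast
    qed
  qed
qed

section \<open>Approximation by truncated operators\<close>

text \<open>For nonnegative numbers the difference is at most the sum, so its square is at most the
  difference of the squares. This is the origin of the square root in the radius of (4).\<close>

lemma abs_diff_less_sqrt:
  fixes s t d :: real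
  assumes "s \<ge> 0" "t \<ge> 0" "\<bar>s\<^sup>2 - t\<^sup>2\<bar> < d"
  shows "\<bar>s - t\<bar> < sqrt d"
proof -
  have "\<bar>s - t\<bar> * \<bar>s - t\<bar> \<le> \<bar>s - t\<bar> * \<bar>s + t\<bar>"
    using assms(1,2) by (intro mult_left_mono) auto
  also have "\<dots> = \<bar>s\<^sup>2 - t\<^sup>2\<bar>"
    by (simp add: abs_mult[symmetric] power2_eq_square algebra_simps)
  finally have "(s - t)\<^sup>2 < d"
    using assms(3) by (simp add: power2_eq_square)
  then have "sqrt ((s - t)\<^sup>2) < sqrt d" by (rule real_sqrt_less_mono)
  then show ?thesis by simp
qed

text \<open>All that the main argument uses about band operators: the parts of \<open>S\<close> and
  of its adjoint leading out of the truncated spaces are small.\<close>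

locale truncation =
  fixes S S' :: "ell2 \<Rightarrow> ell2" and n :: "nat \<Rightarrow> nat" and c :: "nat \<Rightarrow> real"
  assumes SS': "adjoint_pair S S'"
    and n: "filterlim n at_top sequentially"
    and c: "c \<longlonglongrightarrow> 0" "\<And>k. c k \<ge> 0"
    and off: "\<And>k x. x \<in> range (trunc (n k)) \<Longrightarrow> norm (S x - trunc (n k) (S x)) \<le> c k * norm x"
    and off': "\<And>k x. x \<in> range (trunc (n k)) \<Longrightarrow> norm (S' x - trunc (n k) (S' x)) \<le> c k * norm x"
begin

abbreviation "U k \<equiv> range (trunc (n k))"
abbreviation "P k \<equiv> trunc (n k)"

definition A :: "nat \<Rightarrow> ell2 \<Rightarrow> ell2"
  where "A k = P k \<circ> S \<circ> P k"

definition A' :: "nat \<Rightarrow> ell2 \<Rightarrow> ell2"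
  where "A' k = P k \<circ> S' \<circ> P k"

lemma clinear_S: "bounded_clinear S" and clinear_S': "bounded_clinear S'"
  using SS' by (auto simp: adjoint_pair_def)

lemma adjoint_pair_A: "adjoint_pair (A k) (A' k)"
  using adjoint_pair_compose[OF adjoint_pair_trunc adjoint_pair_compose[OF SS' adjoint_pair_trunc]]
  by (simp add: A_def A'_def comp_def)

lemma clinear_A: "bounded_clinear (A k)"
  using adjoint_pair_A by (auto simp: adjoint_pair_def)

lemma A_image: "A k ` X \<subseteq> U k" and A'_image: "A' k ` X \<subseteq> U k"
  by (auto simp: A_def A'_def)

lemma resolvent_diff_le:
  assumes "x \<in> U k"
  shows "norm (resolvent_op z S x - resolvent_op z (A k) x) \<le> c k * norm x"
proof -
  have "resolvent_op z S x - resolvent_op z (A k) x = - (S x - P k (S x))"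
    using assms by (simp add: range_trunc_iff resolvent_op_def A_def)
  then show ?thesis using off[OF assms] by (metis norm_minus_cancel)
qed

text \<open>Evaluate the bound at \<open>P k x\<close>, which tends to \<open>x\<close>.
  \<open>B\<close> and \<open>C\<close> are kept general to cover both the resolvents of
  \<open>S\<close> and those of its square \<open>H\<close>; infinitely many \<open>k\<close> must
  suffice, as the hypothesis arises by negating an eventual statement.\<close>

lemma bounded_below_limit:
  assumes B: "bounded_clinear B"
    and diff: "\<And>k x. x \<in> U k \<Longrightarrow> norm (B x - C k x) \<le> d k * norm x" and d: "d \<longlonglongrightarrow> 0"
    and below: "\<exists>\<^sub>F k in sequentially. \<forall>x\<in>U k. e * norm x \<le> norm (C k x)"
  shows "e * norm x \<le> norm (B x)"
proof (rule ccontr)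
  assume neg: "\<not> e * norm x \<le> norm (B x)"
  have "(\<lambda>k. P k x) \<longlonglongrightarrow> x" by (rule tendsto_trunc[OF n])
  moreover from this have "(\<lambda>k. B (P k x)) \<longlonglongrightarrow> B x"
    by (rule bounded_linear.tendsto[OF bounded_clinearD(1)[OF B]])
  ultimately have "(\<lambda>k. norm (B (P k x)) + d k * norm (P k x) - e * norm (P k x))
      \<longlonglongrightarrow> norm (B x) + 0 * norm x - e * norm x"
    by (intro tendsto_add tendsto_diff tendsto_mult tendsto_norm d tendsto_const)
  then have "\<forall>\<^sub>F k in sequentially. norm (B (P k x)) + d k * norm (P k x) - e * norm (P k x) < 0"
    by (rule order_tendstoD) (use neg in simp)
  from frequently_eventually_frequently[OF below this]
  obtain k where k: "norm (B (P k x)) + d k * norm (P k x) - e * norm (P k x) < 0"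
    "\<forall>x\<in>U k. e * norm x \<le> norm (C k x)"
    using frequently_ex by blast
  then have "e * norm (P k x) \<le> norm (C k (P k x))" by blast
  also have "\<dots> \<le> norm (B (P k x)) + norm (B (P k x) - C k (P k x))"
    by norm
  also have "\<dots> \<le> norm (B (P k x)) + d k * norm (P k x)"
    using diff[of "P k x" k] by simp
  finally show False using k(1) by simp
qed

text \<open>Surjectivity needs no information on the adjoint: solutions of the truncated equations
  \<open>(z - A\<^sub>k) x\<^sub>k = P\<^sub>k y\<close> stay bounded, and therefore \<open>(z - S) x\<^sub>k\<close> tends to \<open>y\<close>.\<close>

lemma surj_limit:
  assumes below: "\<exists>\<^sub>F k in sequentially. \<forall>x\<in>U k. e * norm x \<le> norm (resolvent_op z (A k) x)"
    and "e > 0"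
  shows "surj (resolvent_op z S)"
proof -
  let ?B = "resolvent_op z S"
  have B: "bounded_clinear ?B" by (rule bounded_clinear_resolvent_op[OF clinear_S])
  have "e * norm x \<le> norm (?B x)" for x
    by (rule bounded_below_limit[OF B resolvent_diff_le c(1) below])
  then have "complete (range ?B)"
    using \<open>e > 0\<close> by (intro complete_isometric_image[of e] bounded_clinearD(1)[OF B])
      (auto simp: complete_UNIV)
  then have "closed (range ?B)" by (rule complete_imp_closed)
  moreover have "y \<in> closure (range ?B)" for y
    unfolding closure_approachable
  proof (intro allI impI)
    fix r :: real assume "r > 0"
    \<comment> \<open>This expression bounds the distance from \<open>y\<close> to the image under
      \<open>?B\<close> of the truncated solution. As the range is closed, approximating
      \<open>y\<close> is enough.\<close>
    have "(\<lambda>k. norm (P k y - y) + c k * (norm y / e)) \<longlonglongrightarrow> norm (y - y) + 0 * (norm y / e)"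
      by (intro tendsto_add tendsto_diff tendsto_mult tendsto_norm c tendsto_const tendsto_trunc n)
    then have "\<forall>\<^sub>F k in sequentially. norm (P k y - y) + c k * (norm y / e) < r"
      by (rule order_tendstoD) (use \<open>r > 0\<close> in simp)
    from frequently_eventually_frequently[OF below this]
    obtain k where k: "norm (P k y - y) + c k * (norm y / e) < r"
      and below: "\<And>x. x \<in> U k \<Longrightarrow> e * norm x \<le> norm (resolvent_op z (A k) x)"
      using frequently_ex by blast
    have "U k \<subseteq> resolvent_op z (A k) ` U k"
      by (rule bounded_below_on_range_trunc_imp_surj[OF _ _ \<open>e > 0\<close> below])
        (intro bounded_clinear_resolvent_op clinear_A resolvent_op_image_subset
          subspace_range_trunc A_image)+
    then obtain x where x: "x \<in> U k" "resolvent_op z (A k) x = P k y"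
      by (metis imageE rangeI subsetD)
    have "norm x \<le> norm y / e"
      using below[OF x(1)] norm_trunc_le[of "n k" y] x(2) \<open>e > 0\<close> by (simp add: field_simps)
    then have "c k * norm x \<le> c k * (norm y / e)" using c(2) by (rule mult_left_mono)
    moreover have "norm (?B x - y) \<le> norm (P k y - y) + norm (?B x - resolvent_op z (A k) x)"
      unfolding x(2) by norm
    ultimately have "dist (?B x) y < r"
      using resolvent_diff_le[OF x(1), of z] k by (simp add: dist_norm)
    then show "\<exists>w\<in>range ?B. dist w y < r" by blast
  qed
  ultimately show ?thesis by (metis UNIV_eq_I closure_closed)
qed

subsection \<open>Pseudospectra\<close>

lemma notin_pseudospectrum_A_iff:
  assumes "\<epsilon> > 0"
  shows "z \<notin> pseudospectrum_on (U k) \<epsilon> (A k) \<longleftrightarrow>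
    (\<exists>e>\<epsilon>. \<forall>x\<in>U k. e * norm x \<le> norm (resolvent_op z (A k) x))"
proof -
  have "U k \<subseteq> resolvent_op z (A k) ` U k"
    if "e > \<epsilon>" "\<forall>x\<in>U k. e * norm x \<le> norm (resolvent_op z (A k) x)" for e
    by (rule bounded_below_on_range_trunc_imp_surj[where e = e])
      (use that assms bounded_clinear_resolvent_op[OF clinear_A]
        resolvent_op_image_subset[OF subspace_range_trunc A_image] in auto)
  then show ?thesis
    unfolding notin_pseudospectrum_on_iff[OF clinear_A subspace_range_trunc A_image assms] by blast
qed

lemma notin_pseudospectrum_S_iff:
  assumes "\<epsilon> > 0"
  shows "z \<notin> pseudospectrum_on UNIV \<epsilon> S \<longleftrightarrow>
    surj (resolvent_op z S) \<and> (\<exists>e>\<epsilon>. \<forall>x. e * norm x \<le> norm (resolvent_op z S x))"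
  using notin_pseudospectrum_on_iff[OF clinear_S ell2.subspace_UNIV _ assms, of z] by auto

lemma resolvent_below_transfer:
  assumes "\<And>x. e * norm x \<le> norm (resolvent_op z S x)" and "x \<in> U k"
  shows "(e - c k) * norm x \<le> norm (resolvent_op z (A k) x)"
proof -
  have "norm (resolvent_op z S x) \<le>
      norm (resolvent_op z (A k) x) + norm (resolvent_op z S x - resolvent_op z (A k) x)"
    by norm
  then show ?thesis
    using assms(1)[of x] resolvent_diff_le[OF assms(2), of z] by (simp add: algebra_simps)
qed

lemma pseudospectrum_A_subset:
  assumes "\<epsilon> > 0"
  shows "pseudospectrum_on (U k) \<epsilon> (A k) \<subseteq> pseudospectrum_on UNIV (\<epsilon> + c k) S"
proof
  fix z assume z: "z \<in> pseudospectrum_on (U k) \<epsilon> (A k)"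
  show "z \<in> pseudospectrum_on UNIV (\<epsilon> + c k) S"
  proof (rule ccontr)
    have "\<epsilon> + c k > 0" using assms c(2)[of k] by simp
    moreover assume "z \<notin> pseudospectrum_on UNIV (\<epsilon> + c k) S"
    ultimately obtain e where e: "e > \<epsilon> + c k" "\<And>x. e * norm x \<le> norm (resolvent_op z S x)"
      using notin_pseudospectrum_S_iff by blast
    then have "z \<notin> pseudospectrum_on (U k) \<epsilon> (A k)"
      unfolding notin_pseudospectrum_A_iff[OF assms] using resolvent_below_transfer[OF e(2)]
      by (intro exI[of _ "e - c k"]) auto
    then show False using z by simp
  qed
qed

lemma resolvent_op_lipschitz:
  "norm (resolvent_op w B x) \<le> norm (resolvent_op z B x) + cmod (w - z) * norm x"
proof -
  have "resolvent_op w B x = resolvent_op z B x + (w - z) *\<^sub>C x"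
    by (simp add: resolvent_op_def cscale_diff_left)
  then show ?thesis
    using norm_triangle_ineq[of "resolvent_op z B x" "(w - z) *\<^sub>C x"] by (simp add: norm_cscale)
qed

lemma norm_A_le: "norm (A k x) \<le> onorm S * norm x"
proof -
  have "norm (A k x) \<le> norm (S (P k x))" by (simp add: A_def norm_trunc_le)
  also have "\<dots> \<le> onorm S * norm (P k x)" by (rule bounded_clinearD(8)[OF clinear_S])
  also have "\<dots> \<le> onorm S * norm x"
    by (intro mult_left_mono norm_trunc_le bounded_clinearD(9)[OF clinear_S])
  finally show ?thesis .
qed

lemma resolvent_A_below: "(cmod z - onorm S) * norm x \<le> norm (resolvent_op z (A k) x)"
proof -
  have "norm (z *\<^sub>C x) \<le> norm (resolvent_op z (A k) x) + norm (A k x)"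
    unfolding resolvent_op_def by norm
  then show ?thesis using norm_A_le[of k x] by (simp add: norm_cscale algebra_simps)
qed

lemma pseudospectrum_A_bounded:
  assumes "\<epsilon> > 0"
  shows "pseudospectrum_on (U k) \<epsilon> (A k) \<subseteq> cball 0 (onorm S + \<epsilon>)"
proof
  fix z assume z: "z \<in> pseudospectrum_on (U k) \<epsilon> (A k)"
  have "\<not> cmod z - onorm S > \<epsilon>"
    using z notin_pseudospectrum_A_iff[OF assms, of z k] resolvent_A_below by blast
  then show "z \<in> cball 0 (onorm S + \<epsilon>)" by simp
qed

text \<open>For large \<open>z\<close> the evident lower bound holds for every truncation, and the
  limit lemmas carry it to \<open>S\<close> together with surjectivity; this takes the place of a
  Neumann series.\<close>

lemma pseudospectrum_S_bounded:
  assumes "\<epsilon> > 0"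
  shows "bounded (pseudospectrum_on UNIV \<epsilon> S)"
proof (rule boundedI)
  fix z assume z: "z \<in> pseudospectrum_on UNIV \<epsilon> S"
  show "norm z \<le> onorm S + \<epsilon>"
  proof (rule ccontr)
    assume big: "\<not> norm z \<le> onorm S + \<epsilon>"
    have below: "\<exists>\<^sub>F k in sequentially. \<forall>x\<in>U k.
        (cmod z - onorm S) * norm x \<le> norm (resolvent_op z (A k) x)"
      by (intro eventually_frequently) (auto simp: resolvent_A_below)
    have "surj (resolvent_op z S)"
      by (rule surj_limit[OF below]) (use big assms in simp)
    moreover have "(cmod z - onorm S) * norm x \<le> norm (resolvent_op z S x)" for x
      by (rule bounded_below_limit[OF bounded_clinear_resolvent_op[OF clinear_S]
            resolvent_diff_le c(1) below])
    moreover have "cmod z - onorm S > \<epsilon>" using big by simp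
    ultimately have "z \<notin> pseudospectrum_on UNIV \<epsilon> S"
      using notin_pseudospectrum_S_iff[OF assms] by blast
    then show False using z by simp
  qed
qed

lemma pseudospectrum_A_tendsto:
  assumes "\<epsilon> > 0"
  shows "set_tendsto (\<lambda>k. pseudospectrum_on (U k) \<epsilon> (A k)) (pseudospectrum_on UNIV \<epsilon> S)"
proof (rule set_tendstoI)
  fix r :: real assume "r > 0"
  let ?X = "\<lambda>k. pseudospectrum_on (U k) \<epsilon> (A k)"
  let ?Y = "pseudospectrum_on UNIV \<epsilon> S"
  show "\<forall>\<^sub>F k in sequentially. \<forall>x\<in>?X k. \<exists>y\<in>?Y. dist x y < r"
  proof (rule eventually_subset_nbhd_of_compact[OF compact_cball pseudospectrum_A_bounded[OF assms]])
    fix z assume "z \<notin> ?Y"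
    then obtain e where e: "e > \<epsilon>" "\<And>x. e * norm x \<le> norm (resolvent_op z S x)"
      using notin_pseudospectrum_S_iff[OF assms] by blast
    \<comment> \<open>Half of the surplus \<open>e - \<epsilon>\<close> absorbs the truncation
      error, the other half the displacement from \<open>z\<close> to \<open>w\<close>.\<close>
    define \<rho> where "\<rho> = (e - \<epsilon>) / 2"
    have "\<rho> > 0" using e(1) by (simp add: \<rho>_def)
    have "\<forall>\<^sub>F k in sequentially. c k < \<rho>"
      using c(1) \<open>\<rho> > 0\<close> by (rule order_tendstoD)
    then have "\<forall>\<^sub>F k in sequentially. ball z \<rho> \<inter> ?X k = {}"
    proof eventually_elim
      case (elim k)
      have "w \<notin> ?X k" if "dist z w < \<rho>" for w
        unfolding notin_pseudospectrum_A_iff[OF assms]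
      proof (intro exI[of _ "e - c k - dist z w"] conjI ballI)
        show "\<epsilon> < e - c k - dist z w" using elim that by (simp add: \<rho>_def field_simps)
        fix x assume "x \<in> U k"
        then show "(e - c k - dist z w) * norm x \<le> norm (resolvent_op w (A k) x)"
          using resolvent_below_transfer[OF e(2)] resolvent_op_lipschitz[of z "A k" x w]
          by (fastforce simp: algebra_simps dist_norm)
      qed
      then show ?case by auto
    qed
    then show "\<exists>\<rho>>0. \<forall>\<^sub>F k in sequentially. ball z \<rho> \<inter> ?X k = {}"
      using \<open>\<rho> > 0\<close> by blast
  qed fact
  show "\<forall>\<^sub>F k in sequentially. \<forall>y\<in>?Y. \<exists>x\<in>?X k. dist y x < r"
  proof (rule eventually_near_bounded[OF pseudospectrum_S_bounded[OF assms] _ \<open>r > 0\<close>])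
    fix z and r :: real assume z: "z \<in> ?Y" and "r > 0"
    show "\<forall>\<^sub>F k in sequentially. \<exists>w\<in>?X k. dist z w < r"
    proof (rule ccontr)
      assume "\<not> ?thesis"
      \<comment> \<open>The same infinitely many \<open>k\<close> serve the whole disc around
        \<open>z\<close>, so lower bounds reach \<open>S\<close> at every point of it.\<close>
      then have freq: "\<exists>\<^sub>F k in sequentially. \<forall>w. dist z w < r \<longrightarrow> w \<notin> ?X k"
        unfolding not_eventually by (rule frequently_mono[rotated]) blast
      have below: "\<exists>\<^sub>F k in sequentially. \<forall>x\<in>U k. \<epsilon> * norm x \<le> norm (resolvent_op w (A k) x)"
        if "dist z w < r" for w
        using freq
      proof (rule frequently_mono[rotated], intro allI impI ballI)
        fix k x assume k: "\<forall>w. dist z w < r \<longrightarrow> w \<notin> ?X k" and x: "x \<in> U k"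
        then obtain e where "e > \<epsilon>" "e * norm x \<le> norm (resolvent_op w (A k) x)"
          using \<open>dist z w < r\<close> notin_pseudospectrum_A_iff[OF assms] by blast
        then show "\<epsilon> * norm x \<le> norm (resolvent_op w (A k) x)"
          using mult_right_mono[of \<epsilon> e "norm x"] by simp
      qed
      have S_below: "\<epsilon> * norm x \<le> norm (resolvent_op w S x)" if "dist z w < r" for w x
        by (rule bounded_below_limit[OF bounded_clinear_resolvent_op[OF clinear_S]
              resolvent_diff_le c(1) below[OF that]])
      have surj: "surj (resolvent_op z S)"
        using below[of z] assms \<open>r > 0\<close> by (intro surj_limit) auto
      \<comment> \<open>The numbers above \<open>\<epsilon>\<close> for the truncations may tend to
        \<open>\<epsilon>\<close>, so strictness is lost in the limit. It is regained at
        \<open>z\<close> from the weak bound on the disc.\<close>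
      have "\<exists>e>\<epsilon>. \<forall>x. e * norm x \<le> norm (resolvent_op z S x)"
      proof (rule bounded_below_near_imp_strict[OF _ surj assms \<open>r > 0\<close>])
        show "bounded_clinear (resolvent_op z S)"
          by (rule bounded_clinear_resolvent_op[OF clinear_S])
        fix h x assume "cmod h < r"
        then have "\<epsilon> * norm x \<le> norm (resolvent_op (z + h) S x)"
          by (intro S_below) (simp add: dist_norm)
        then show "\<epsilon> * norm x \<le> norm (resolvent_op z S x + h *\<^sub>C x)"
          by (simp add: resolvent_op_def cscale_add_left algebra_simps)
      qed
      then show False using z surj notin_pseudospectrum_S_iff[OF assms] by blast
    qed
  qed
qed

subsection \<open>Singular values\<close>

definition H :: "ell2 \<Rightarrow> ell2"
  where "H = S' \<circ> S"

text \<open>The square belonging to the truncation itself, not the truncation of \<open>H\<close>: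
  the extra projection between the two factors is one of the two sources of error in
  \<open>H_diff_le\<close>.\<close>

definition H\<^sub>t :: "nat \<Rightarrow> ell2 \<Rightarrow> ell2"
  where "H\<^sub>t k = A' k \<circ> A k"

lemma selfadjoint_H: "adjoint_pair H H"
  using adjoint_pair_compose[OF adjoint_pair_sym[OF SS'] SS'] by (simp add: H_def comp_def)

lemma selfadjoint_Ht: "adjoint_pair (H\<^sub>t k) (H\<^sub>t k)"
  using adjoint_pair_compose[OF adjoint_pair_sym[OF adjoint_pair_A] adjoint_pair_A]
  by (simp add: H\<^sub>t_def comp_def)

lemma Ht_image: "H\<^sub>t k ` X \<subseteq> U k"
  by (auto simp: H\<^sub>t_def A'_def)

lemmas H_spectrum = selfadjoint_H ell2.subspace_UNIV complete_UNIV subset_UNIV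
lemmas Ht_spectrum = selfadjoint_Ht subspace_range_trunc complete_range_trunc Ht_image

lemma spectrum_S: "spectrum_on UNIV (adjoint_on UNIV S \<circ> S) = spectrum_on UNIV H"
  by (rule spectrum_on_cong)
    (simp add: H_def adjoint_on_eq[OF SS' ell2.subspace_UNIV subset_UNIV])

lemma spectrum_A: "spectrum_on (U k) (adjoint_on (U k) (A k) \<circ> A k) = spectrum_on (U k) (H\<^sub>t k)"
proof (rule spectrum_on_cong)
  fix x assume "x \<in> U k"
  then have "A k x \<in> U k" using A_image[of k "{x}"] by simp
  then show "(adjoint_on (U k) (A k) \<circ> A k) x = H\<^sub>t k x"
    using adjoint_on_eq[OF adjoint_pair_A subspace_range_trunc A'_image] by (simp add: H\<^sub>t_def)
qed

lemma norm_S'_le: "norm (S' x) \<le> onorm S * norm x"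
  by (rule adjoint_pair_norm_le[OF SS' bounded_clinearD(8)[OF clinear_S]])

text \<open>For \<open>x\<close> in the truncated space, with \<open>u = S x - P S x\<close> and \<open>v = P S x\<close>, the residual is
  \<open>S\<^sup>* u + (1 - P) S\<^sup>* v\<close>. Since \<open>\<parallel>u\<parallel>\<^sup>2 + \<parallel>v\<parallel>\<^sup>2 \<le> \<parallel>S\<parallel>\<^sup>2 \<parallel>x\<parallel>\<^sup>2\<close>, the bounds \<open>\<parallel>u\<parallel> \<le> c \<parallel>x\<parallel>\<close> and
  \<open>\<parallel>v\<parallel> \<le> \<parallel>S\<parallel> \<parallel>x\<parallel>\<close> cannot both be attained, which makes the estimate strict.\<close>

lemma H_diff_le:
  assumes "x \<in> U k"
  shows "norm (H x - H\<^sub>t k x) \<le> 2 * onorm S * c k * norm x"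
    and "0 < onorm S * c k \<Longrightarrow> x \<noteq> 0 \<Longrightarrow> norm (H x - H\<^sub>t k x) < 2 * onorm S * c k * norm x"
proof -
  define s where "s = onorm S"
  define u where "u = S x - P k (S x)"
  define v where "v = P k (S x)"
  have s0: "s \<ge> 0" unfolding s_def by (rule bounded_clinearD(9)[OF clinear_S])
  have "H x - H\<^sub>t k x = S' u + (S' v - P k (S' v))"
    using assms
    by (simp add: range_trunc_iff H_def H\<^sub>t_def A_def A'_def u_def v_def bounded_clinearD(4)[OF clinear_S'])
  then have "norm (H x - H\<^sub>t k x) \<le> norm (S' u) + norm (S' v - P k (S' v))"
    by (simp add: norm_triangle_ineq)
  also have "\<dots> \<le> s * norm u + c k * norm v"
    unfolding s_def by (intro add_mono norm_S'_le off') (simp add: v_def)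
  finally have le: "norm (H x - H\<^sub>t k x) \<le> s * norm u + c k * norm v" .
  have u: "norm u \<le> c k * norm x" unfolding u_def by (rule off[OF assms])
  have Sx: "norm (S x) \<le> s * norm x" unfolding s_def by (rule bounded_clinearD(8)[OF clinear_S])
  have v: "norm v \<le> s * norm x"
    unfolding v_def by (rule order_trans[OF norm_trunc_le Sx])
  have su: "s * norm u \<le> s * (c k * norm x)" and cv: "c k * norm v \<le> c k * (s * norm x)"
    using s0 c(2) u v by (auto intro: mult_left_mono)
  show "norm (H x - H\<^sub>t k x) \<le> 2 * onorm S * c k * norm x"
    using le su cv by (simp add: s_def algebra_simps)
  assume pos: "0 < onorm S * c k" and "x \<noteq> 0"
  then have sc: "s > 0" "c k > 0"
    using s0 c(2)[of k] by (auto simp: s_def zero_less_mult_iff)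
  have "s * norm u + c k * norm v < s * (c k * norm x) + c k * (s * norm x)"
  proof (cases "norm u < c k * norm x")
    case True
    then show ?thesis using sc cv by (intro add_less_le_mono) auto
  next
    case False
    moreover have "0 < c k * norm x" using sc \<open>x \<noteq> 0\<close> by simp
    ultimately have "norm u > 0" by linarith
    have "(norm u)\<^sup>2 + (norm v)\<^sup>2 = (norm (S x))\<^sup>2"
      unfolding u_def v_def by (rule norm_trunc_Pythagorean)
    also have "\<dots> \<le> (s * norm x)\<^sup>2" using Sx by (intro power_mono) auto
    finally have "(norm v)\<^sup>2 < (s * norm x)\<^sup>2"
      using zero_less_power[OF \<open>norm u > 0\<close>, of 2] by linarith
    then have "norm v < s * norm x" by (rule power2_less_imp_less) (use s0 in simp)
    then show ?thesis using sc su by (intro add_le_less_mono) auto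
  qed
  then show "norm (H x - H\<^sub>t k x) < 2 * onorm S * c k * norm x"
    using le by (simp add: s_def algebra_simps)
qed

lemma H_nonneg: "0 \<le> inner (H x) x" and Ht_nonneg: "0 \<le> inner (H\<^sub>t k x) x"
  by (simp_all add: H_def H\<^sub>t_def adjoint_pair_inner[OF adjoint_pair_sym[OF SS']]
      adjoint_pair_inner[OF adjoint_pair_sym[OF adjoint_pair_A]])

lemma H_spectrum_nonneg: "z \<in> spectrum_on UNIV H \<Longrightarrow> \<exists>\<mu>\<ge>0. z = complex_of_real \<mu>"
  by (rule positive_spectrum_on_nonneg[OF H_spectrum H_nonneg])

lemma Ht_spectrum_nonneg: "z \<in> spectrum_on (U k) (H\<^sub>t k) \<Longrightarrow> \<exists>\<mu>\<ge>0. z = complex_of_real \<mu>"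
  by (rule positive_spectrum_on_nonneg[OF Ht_spectrum Ht_nonneg])

lemma H_spectrum_bounded:
  assumes "complex_of_real \<mu> \<in> spectrum_on UNIV H"
  shows "\<mu> \<le> (onorm S)\<^sup>2"
proof (rule ccontr)
  assume big: "\<not> \<mu> \<le> (onorm S)\<^sup>2"
  have "(\<mu> - (onorm S)\<^sup>2) * norm x \<le> norm (resolvent_op (complex_of_real \<mu>) H x)" for x
  proof -
    have "norm (H x) \<le> onorm S * norm (S x)" by (simp add: H_def norm_S'_le)
    also have "\<dots> \<le> onorm S * (onorm S * norm x)"
      by (intro mult_left_mono bounded_clinearD(8,9)[OF clinear_S])
    finally have "norm (H x) \<le> (onorm S)\<^sup>2 * norm x" by (simp add: power2_eq_square)
    moreover have "norm (complex_of_real \<mu> *\<^sub>C x) \<le> norm (resolvent_op (complex_of_real \<mu>) H x) + norm (H x)"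
      unfolding resolvent_op_def by norm
    moreover have "\<mu> * norm x \<le> norm (complex_of_real \<mu> *\<^sub>C x)"
      by (simp add: norm_cscale mult_right_mono)
    ultimately show ?thesis by (simp add: left_diff_distrib)
  qed
  then show False
    using assms selfadjoint_notin_spectrum_on_iff[OF H_spectrum, of \<mu>] big
    by (metis diff_gt_0_iff_gt not_le)
qed

text \<open>In finite dimension \<open>\<nu>\<close> has an eigenvector, which is an approximate
  eigenvector of \<open>H\<close>. The strict form of \<open>H_diff_le\<close> then excludes a
  spectral gap of the full radius.\<close>

lemma Ht_spectrum_near:
  assumes "complex_of_real \<nu> \<in> spectrum_on (U k) (H\<^sub>t k)"
  shows "\<exists>\<mu>\<ge>0. complex_of_real \<mu> \<in> spectrum_on UNIV H \<and>
    (\<mu> = \<nu> \<or> \<bar>\<mu> - \<nu>\<bar> < 2 * onorm S * c k)"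
proof -
  let ?R = "\<lambda>T. resolvent_op (complex_of_real \<nu>) T"
  have Ht: "bounded_clinear (?R (H\<^sub>t k))" "?R (H\<^sub>t k) ` U k \<subseteq> U k"
    using selfadjoint_Ht resolvent_op_image_subset[OF subspace_range_trunc Ht_image]
    by (auto simp: adjoint_pair_def bounded_clinear_resolvent_op)
  obtain x where x: "x \<in> U k" "?R (H\<^sub>t k) x = 0" "x \<noteq> 0"
    using assms injective_on_range_trunc(2)[OF Ht]
    unfolding selfadjoint_notin_spectrum_on_iff[OF Ht_spectrum, THEN arg_cong, of Not, unfolded not_not]
    by blast
  have R: "norm (?R H x) = norm (H x - H\<^sub>t k x)"
  proof -
    have "?R H x = - (H x - H\<^sub>t k x)" using x(2) by (simp add: resolvent_op_def)
    then show ?thesis by (metis norm_minus_cancel)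
  qed
  have "\<exists>\<mu>. complex_of_real \<mu> \<in> spectrum_on UNIV H \<and>
      (\<mu> = \<nu> \<or> \<bar>\<mu> - \<nu>\<bar> < 2 * onorm S * c k)"
  proof (cases "0 < onorm S * c k")
    case True
    show ?thesis
    proof (rule ccontr)
      assume "\<not> ?thesis"
      then have "2 * onorm S * c k * norm x \<le> norm (?R H x)"
        by (intro selfadjoint_spectral_gap[OF H_spectrum]) auto
      then show False using H_diff_le(2)[OF x(1) True x(3)] R by simp
    qed
  next
    \<comment> \<open>The radius is 0 here, and the eigenvector is a genuine eigenvector of
      \<open>H\<close>.\<close>
    case False
    then have "onorm S * c k = 0"
      using mult_nonneg_nonneg[OF bounded_clinearD(9)[OF clinear_S] c(2)[of k]] by simp
    then have "2 * onorm S * c k * norm x = 0" by auto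
    then have "norm (?R H x) = 0"
      using H_diff_le(1)[OF x(1)] unfolding R by (metis norm_ge_zero order_antisym)
    moreover have "norm x > 0" using x(3) by simp
    ultimately have "\<not> e * norm x \<le> norm (?R H x)" if "e > 0" for e
      using that by (simp only: not_le mult_pos_pos)
    then have "\<not> (\<exists>e>0. \<forall>x\<in>UNIV. e * norm x \<le> norm (?R H x))"
      by blast
    then show ?thesis
      using selfadjoint_notin_spectrum_on_iff[OF H_spectrum] by blast
  qed
  then show ?thesis using H_spectrum_nonneg by (metis of_real_eq_iff)
qed

text \<open>Otherwise infinitely many truncations have a spectral gap of radius \<open>d\<close> at
  \<open>\<nu>\<close>; the resulting lower bounds pass to the limit.\<close>

lemma Ht_spectrum_limit:
  assumes \<nu>: "complex_of_real \<nu> \<in> spectrum_on UNIV H" and "d > 0"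
  shows "\<forall>\<^sub>F k in sequentially. \<exists>\<mu>\<ge>0. complex_of_real \<mu> \<in> spectrum_on (U k) (H\<^sub>t k) \<and> \<bar>\<mu> - \<nu>\<bar> < d"
proof (rule ccontr)
  let ?R = "\<lambda>T. resolvent_op (complex_of_real \<nu>) T"
  assume "\<not> ?thesis"
  then have freq: "\<exists>\<^sub>F k in sequentially. \<forall>x\<in>U k. d * norm x \<le> norm (?R (H\<^sub>t k) x)"
    unfolding not_eventually
  proof (rule frequently_mono[rotated], intro allI impI ballI)
    fix k x
    assume "\<not> (\<exists>\<mu>\<ge>0. complex_of_real \<mu> \<in> spectrum_on (U k) (H\<^sub>t k) \<and> \<bar>\<mu> - \<nu>\<bar> < d)" and "x \<in> U k"
    then show "d * norm x \<le> norm (?R (H\<^sub>t k) x)"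
      using Ht_spectrum_nonneg[of _ k]
      by (intro selfadjoint_spectral_gap[OF Ht_spectrum]) (metis of_real_eq_iff)+
  qed
  have "d * norm x \<le> norm (?R H x)" for x
  proof (rule bounded_below_limit[OF _ _ _ freq])
    show "bounded_clinear (?R H)"
      using selfadjoint_H by (simp add: adjoint_pair_def bounded_clinear_resolvent_op)
    show "norm (?R H x - ?R (H\<^sub>t k) x) \<le> 2 * onorm S * c k * norm x" if "x \<in> U k" for k x
      using H_diff_le(1)[OF that] by (simp add: resolvent_op_def norm_minus_commute)
    show "(\<lambda>k. 2 * onorm S * c k) \<longlonglongrightarrow> 0"
      using tendsto_mult[OF tendsto_const c(1), of "2 * onorm S"] by simp
  qed
  then show False
    using \<nu> \<open>d > 0\<close> selfadjoint_notin_spectrum_on_iff[OF H_spectrum] by blast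
qed

lemma singular_values_S:
  "singular_values0_on UNIV S = {complex_of_real s |s. s \<ge> 0 \<and> complex_of_real (s\<^sup>2) \<in> spectrum_on UNIV H}"
  "singular_values_on UNIV S = {complex_of_real s |s. s > 0 \<and> complex_of_real (s\<^sup>2) \<in> spectrum_on UNIV H}"
  by (simp_all add: singular_values0_on_def singular_values_on_def spectrum_S)

lemma singular_values_A:
  "singular_values0_on (U k) (A k) =
    {complex_of_real s |s. s \<ge> 0 \<and> complex_of_real (s\<^sup>2) \<in> spectrum_on (U k) (H\<^sub>t k)}"
  "singular_values_on (U k) (A k) =
    {complex_of_real s |s. s > 0 \<and> complex_of_real (s\<^sup>2) \<in> spectrum_on (U k) (H\<^sub>t k)}"
  by (simp_all add: singular_values0_on_def singular_values_on_def spectrum_A)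

lemma nbhd_eventually:
  assumes "\<And>k. X k \<subseteq> nbhd (sqrt (2 * onorm S * c k)) Y" and "r > 0"
  shows "\<forall>\<^sub>F k in sequentially. \<forall>x\<in>X k. \<exists>y\<in>Y. dist x y < r"
proof -
  have "(\<lambda>k. sqrt (2 * onorm S * c k)) \<longlonglongrightarrow> sqrt (2 * onorm S * 0)"
    by (intro tendsto_intros c)
  then have "\<forall>\<^sub>F k in sequentially. sqrt (2 * onorm S * c k) < r"
    by (rule order_tendstoD) (use \<open>r > 0\<close> in simp)
  then show ?thesis
  proof eventually_elim
    case (elim k)
    show ?case
    proof
      fix x assume "x \<in> X k"
      then have "x \<in> Y \<or> (\<exists>y\<in>Y. dist x y < sqrt (2 * onorm S * c k))"
        using assms(1)[of k] by (auto simp: nbhd_def dist_commute)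
      then show "\<exists>y\<in>Y. dist x y < r"
        using elim \<open>r > 0\<close> by (metis dist_self less_trans)
    qed
  qed
qed

lemma bounded_singular_values: "bounded (singular_values0_on UNIV S)"
proof (rule boundedI)
  fix z assume "z \<in> singular_values0_on UNIV S"
  then obtain s where s: "z = complex_of_real s" "s \<ge> 0" "complex_of_real (s\<^sup>2) \<in> spectrum_on UNIV H"
    unfolding singular_values_S by blast
  then have "s\<^sup>2 \<le> (onorm S)\<^sup>2" using H_spectrum_bounded by blast
  then have "s \<le> onorm S"
    by (rule power2_le_imp_le) (rule bounded_clinearD(9)[OF clinear_S])
  then show "norm z \<le> onorm S"
    using s by simp
qed

lemma singular_values0_A_subset:
  "singular_values0_on (U k) (A k) \<subseteq> nbhd (sqrt (2 * onorm S * c k)) (singular_values0_on UNIV S)"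
proof
  fix z assume "z \<in> singular_values0_on (U k) (A k)"
  then obtain s where s: "z = complex_of_real s" "s \<ge> 0"
    "complex_of_real (s\<^sup>2) \<in> spectrum_on (U k) (H\<^sub>t k)"
    unfolding singular_values_A by blast
  obtain \<mu> where \<mu>: "\<mu> \<ge> 0" "complex_of_real \<mu> \<in> spectrum_on UNIV H"
    "\<mu> = s\<^sup>2 \<or> \<bar>\<mu> - s\<^sup>2\<bar> < 2 * onorm S * c k"
    using Ht_spectrum_near[OF s(3)] by blast
  have mem: "complex_of_real (sqrt \<mu>) \<in> singular_values0_on UNIV S"
    unfolding singular_values_S using \<mu>(1,2) by (auto simp del: of_real_power)
  from \<mu>(3) show "z \<in> nbhd (sqrt (2 * onorm S * c k)) (singular_values0_on UNIV S)"
  proof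
    assume "\<mu> = s\<^sup>2"
    then show ?thesis using mem s by (simp add: nbhd_def)
  next
    assume "\<bar>\<mu> - s\<^sup>2\<bar> < 2 * onorm S * c k"
    then have "\<bar>sqrt \<mu> - s\<bar> < sqrt (2 * onorm S * c k)"
      using \<mu>(1) s(2) by (intro abs_diff_less_sqrt) auto
    then show ?thesis
      using mem unfolding nbhd_def s(1) by (force simp: dist_real_def)
  qed
qed

lemma singular_values0_A_tendsto:
  "set_tendsto (\<lambda>k. singular_values0_on (U k) (A k)) (singular_values0_on UNIV S)"
proof (rule set_tendstoI[OF nbhd_eventually[OF singular_values0_A_subset]])
  fix r :: real assume "r > 0"
  show "\<forall>\<^sub>F k in sequentially. \<forall>y\<in>singular_values0_on UNIV S.
      \<exists>x\<in>singular_values0_on (U k) (A k). dist y x < r"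
  proof (rule eventually_near_bounded[OF bounded_singular_values _ \<open>r > 0\<close>])
    fix z and r :: real assume "z \<in> singular_values0_on UNIV S" "r > 0"
    then obtain t where t: "z = complex_of_real t" "t \<ge> 0" "complex_of_real (t\<^sup>2) \<in> spectrum_on UNIV H"
      unfolding singular_values_S by blast
    from Ht_spectrum_limit[OF t(3), of "r\<^sup>2"] \<open>r > 0\<close>
    have "\<forall>\<^sub>F k in sequentially. \<exists>\<mu>\<ge>0. complex_of_real \<mu> \<in> spectrum_on (U k) (H\<^sub>t k) \<and> \<bar>\<mu> - t\<^sup>2\<bar> < r\<^sup>2"
      by simp
    then show "\<forall>\<^sub>F k in sequentially. \<exists>x\<in>singular_values0_on (U k) (A k). dist z x < r"
    proof eventually_elim
      case (elim k)
      then obtain \<mu> where \<mu>: "\<mu> \<ge> 0" "complex_of_real \<mu> \<in> spectrum_on (U k) (H\<^sub>t k)" "\<bar>\<mu> - t\<^sup>2\<bar> < r\<^sup>2"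
        by blast
      have "\<bar>sqrt \<mu> - t\<bar> < sqrt (r\<^sup>2)"
        using \<mu> t(2) by (intro abs_diff_less_sqrt) auto
      then have "dist z (complex_of_real (sqrt \<mu>)) < r"
        using \<open>r > 0\<close> by (simp add: t(1) dist_real_def abs_minus_commute)
      moreover have "complex_of_real (sqrt \<mu>) \<in> singular_values0_on (U k) (A k)"
        unfolding singular_values_A using \<mu>(1,2) by (auto simp del: of_real_power)
      ultimately show ?case by blast
    qed
  qed
qed

context
  assumes zero_limpt: "0 \<in> spectrum_on UNIV H \<Longrightarrow> 0 islimpt spectrum_on UNIV H"
begin

lemma singular_values_A_subset:
  "singular_values_on (U k) (A k) \<subseteq> nbhd (sqrt (2 * onorm S * c k)) (singular_values_on UNIV S)"
proof
  fix z assume "z \<in> singular_values_on (U k) (A k)"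
  then obtain s where s: "z = complex_of_real s" "s > 0"
    "complex_of_real (s\<^sup>2) \<in> spectrum_on (U k) (H\<^sub>t k)"
    unfolding singular_values_A by blast
  have "\<exists>\<mu>>0. complex_of_real \<mu> \<in> spectrum_on UNIV H \<and>
      (\<mu> = s\<^sup>2 \<or> \<bar>\<mu> - s\<^sup>2\<bar> < 2 * onorm S * c k)"
  proof -
    obtain \<mu> where \<mu>: "\<mu> \<ge> 0" "complex_of_real \<mu> \<in> spectrum_on UNIV H"
      "\<mu> = s\<^sup>2 \<or> \<bar>\<mu> - s\<^sup>2\<bar> < 2 * onorm S * c k"
      using Ht_spectrum_near[OF s(3)] by blast
    show ?thesis
    proof (cases "\<mu> = 0")
      case True
      then have "s\<^sup>2 < 2 * onorm S * c k" using \<mu>(3) s(2) by auto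
      \<comment> \<open>When only 0 is close to the square of \<open>s\<close>, it is traded for a
        spectral value \<open>w\<close> strictly between 0 and that square, whose distance from the
        square is still below the radius.\<close>
      moreover have "0 islimpt spectrum_on UNIV H" using True \<mu>(2) zero_limpt by simp
      then obtain w where w: "w \<in> spectrum_on UNIV H" "w \<noteq> 0" "dist w 0 < s\<^sup>2"
        using s(2) unfolding islimpt_approachable by (metis zero_less_power)
      moreover obtain \<mu>' where \<mu>': "\<mu>' \<ge> 0" "w = complex_of_real \<mu>'"
        using H_spectrum_nonneg[OF w(1)] by blast
      ultimately show ?thesis by (intro exI[of _ \<mu>']) auto
    next
      case False
      then show ?thesis using \<mu> by (intro exI[of _ \<mu>]) simp
    qed
  qed
  then obtain \<mu> where \<mu>: "\<mu> > 0" "complex_of_real \<mu> \<in> spectrum_on UNIV H"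
    "\<mu> = s\<^sup>2 \<or> \<bar>\<mu> - s\<^sup>2\<bar> < 2 * onorm S * c k" by blast
  have mem: "complex_of_real (sqrt \<mu>) \<in> singular_values_on UNIV S"
    unfolding singular_values_S using \<mu>(1,2) by (auto simp del: of_real_power)
  from \<mu>(3) show "z \<in> nbhd (sqrt (2 * onorm S * c k)) (singular_values_on UNIV S)"
  proof
    assume "\<mu> = s\<^sup>2"
    then show ?thesis using mem s by (simp add: nbhd_def)
  next
    assume "\<bar>\<mu> - s\<^sup>2\<bar> < 2 * onorm S * c k"
    then have "\<bar>sqrt \<mu> - s\<bar> < sqrt (2 * onorm S * c k)"
      using \<mu>(1) s(2) by (intro abs_diff_less_sqrt) auto
    then show ?thesis
      using mem unfolding nbhd_def s(1) by (force simp: dist_real_def)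
  qed
qed

lemma singular_values_A_tendsto:
  "set_tendsto (\<lambda>k. singular_values_on (U k) (A k)) (singular_values_on UNIV S)"
proof (rule set_tendstoI[OF nbhd_eventually[OF singular_values_A_subset]])
  fix r :: real assume "r > 0"
  have "singular_values_on UNIV S \<subseteq> singular_values0_on UNIV S"
    by (force simp: singular_values_S)
  then have bdd: "bounded (singular_values_on UNIV S)"
    using bounded_singular_values bounded_subset by blast
  show "\<forall>\<^sub>F k in sequentially. \<forall>y\<in>singular_values_on UNIV S.
      \<exists>x\<in>singular_values_on (U k) (A k). dist y x < r"
  proof (rule eventually_near_bounded[OF bdd _ \<open>r > 0\<close>])
    fix z and r :: real assume "z \<in> singular_values_on UNIV S" "r > 0"
    then obtain t where t: "z = complex_of_real t" "t > 0" "complex_of_real (t\<^sup>2) \<in> spectrum_on UNIV H"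
      unfolding singular_values_S by blast
    \<comment> \<open>The second argument keeps the approximating spectral values positive.\<close>
    define d where "d = min (r\<^sup>2) (t\<^sup>2)"
    have "d > 0" using \<open>r > 0\<close> t(2) by (simp add: d_def)
    from Ht_spectrum_limit[OF t(3) this]
    show "\<forall>\<^sub>F k in sequentially. \<exists>x\<in>singular_values_on (U k) (A k). dist z x < r"
    proof eventually_elim
      case (elim k)
      then obtain \<mu> where \<mu>: "complex_of_real \<mu> \<in> spectrum_on (U k) (H\<^sub>t k)" "\<bar>\<mu> - t\<^sup>2\<bar> < d"
        by blast
      then have "\<mu> > 0" by (simp add: d_def abs_less_iff)
      have "\<bar>sqrt \<mu> - t\<bar> < sqrt (r\<^sup>2)"
        using \<mu>(2) \<open>\<mu> > 0\<close> t(2) by (intro abs_diff_less_sqrt) (auto simp: d_def)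
      then have "dist z (complex_of_real (sqrt \<mu>)) < r"
        using \<open>r > 0\<close> by (simp add: t(1) dist_real_def abs_minus_commute)
      moreover have "complex_of_real (sqrt \<mu>) \<in> singular_values_on (U k) (A k)"
        unfolding singular_values_A using \<mu>(1) \<open>\<mu> > 0\<close> by (auto simp del: of_real_power)
      ultimately show ?case by blast
    qed
  qed
qed

end

end

section \<open>Weighted shifts\<close>

definition left_shift :: "ell2 \<Rightarrow> ell2"
  where "left_shift x = Abs_ell2 (\<lambda>k. coord x (Suc k))"

lemma coord_left_shift: "coord (left_shift x) k = coord x (Suc k)"
  and norm_left_shift_le: "norm (left_shift x) \<le> norm x"
proof -
  have "(\<Sum>k<N. (cmod (coord x (Suc k)))\<^sup>2) \<le> (norm x)\<^sup>2" for N
  proof -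
    have "(\<Sum>k<Suc N. (cmod (coord x k))\<^sup>2) = (cmod (coord x 0))\<^sup>2 + (\<Sum>k<N. (cmod (coord x (Suc k)))\<^sup>2)"
      by (rule sum.lessThan_Suc_shift)
    then show ?thesis
      using sum_coord_le_norm[of x "Suc N"] zero_le_power2[of "cmod (coord x 0)"] by linarith
  qed
  note shift = ell2_of_bounded_sums[OF this norm_ge_zero]
  show "coord (left_shift x) k = coord x (Suc k)"
    by (simp add: left_shift_def coord_Abs_ell2[OF shift(1)])
  show "norm (left_shift x) \<le> norm x"
    unfolding left_shift_def by (rule shift(2))
qed

lemma bounded_clinear_left_shift: "bounded_clinear left_shift"
  by (rule bounded_clinearI[where K = 1])
    (auto intro!: ell2_eqI simp: coord_left_shift coord_simps coord_cscale norm_left_shift_le)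

lemma norm_ebasis: "norm (\<delta> n) = 1"
proof -
  have "(\<Sum>k. (cmod (coord (\<delta> n) k))\<^sup>2) = (\<Sum>k\<in>{n}. (cmod (coord (\<delta> n) k))\<^sup>2)"
    by (rule suminf_finite) (auto simp: coord_ebasis)
  then show ?thesis by (simp add: norm_ell2 coord_ebasis)
qed

lemma norm_diff_trunc_le: "norm (x - trunc n x) \<le> norm x"
proof (rule power2_le_imp_le)
  show "(norm (x - trunc n x))\<^sup>2 \<le> (norm x)\<^sup>2"
    using norm_trunc_Pythagorean[of x n] zero_le_power2[of "norm (trunc n x)"] by linarith
qed simp

lemma range_trunc_iff_coord: "x \<in> range (trunc n) \<longleftrightarrow> (\<forall>k>n. coord x k = 0)"
proof -
  have "trunc n x = x \<longleftrightarrow> (\<forall>k. coord (trunc n x) k = coord x k)"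
    using ell2_eqI by metis
  then show ?thesis by (auto simp: range_trunc_iff coord_trunc)
qed

lemma mult_op_trunc:
  assumes "bounded (range g)"
  shows "mult_op g (trunc n x) = trunc n (mult_op g x)"
  by (rule ell2_eqI) (simp add: coord_mult_op[OF assms] coord_trunc)

lemma trunc_sum: "trunc n (\<Sum>j\<in>J. R j) = (\<Sum>j\<in>J. trunc n (R j))"
  by (rule linear_sum[OF bounded_linear.linear[OF bounded_clinearD(1)[OF bounded_clinear_trunc]]])

lemma off_trunc_sum_le:
  assumes "\<And>j. j \<in> J \<Longrightarrow> norm (R j - trunc n (R j)) \<le> b j"
  shows "norm ((\<Sum>j\<in>J. R j) - trunc n (\<Sum>j\<in>J. R j)) \<le> (\<Sum>j\<in>J. b j)"
proof -
  have "(\<Sum>j\<in>J. R j) - trunc n (\<Sum>j\<in>J. R j) = (\<Sum>j\<in>J. R j - trunc n (R j))"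
    by (simp add: trunc_sum sum_subtractf)
  then show ?thesis
    using assms by (simp add: sum_norm_le)
qed

context
  fixes \<alpha> :: "nat \<Rightarrow> complex" and T :: "ell2 \<Rightarrow> ell2"
  assumes \<alpha>: "bounded (range \<alpha>)" and T: "bounded_clinear T"
    and T_ebasis: "\<And>n. T (\<delta> n) = \<alpha> n *\<^sub>C \<delta> (Suc n)"
begin

text \<open>\<open>T\<close> is prescribed on the basis only. Linearity gives the coordinates on
  truncated vectors, where each is eventually constant in \<open>N\<close>, and continuity gives the
  rest.\<close>

lemma coord_weighted_shift: "coord (T x) 0 = 0" "coord (T x) (Suc k) = \<alpha> k * coord x k"
proof -
  note linT = bounded_linear.linear[OF bounded_clinearD(1)[OF T]]
  have T_trunc: "coord (T (trunc N x)) j = (\<Sum>k\<le>N. if j = Suc k then \<alpha> k * coord x k else 0)" for N j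
    unfolding trunc_eq_sum linear_sum[OF linT] coord_sum
    by (intro sum.cong)
      (auto simp: bounded_clinearD(2)[OF T] T_ebasis coord_cscale coord_ebasis)
  have lim: "(\<lambda>N. coord (T (trunc N x)) j) \<longlonglongrightarrow> coord (T x) j" for j
    by (intro bounded_linear.tendsto[OF bounded_linear_coord]
        bounded_linear.tendsto[OF bounded_clinearD(1)[OF T]] tendsto_trunc filterlim_ident)
  show "coord (T x) 0 = 0"
    using lim[of 0] unfolding T_trunc by (simp add: LIMSEQ_const_iff)
  have "\<forall>\<^sub>F N in sequentially. coord (T (trunc N x)) (Suc k) = \<alpha> k * coord x k"
    unfolding T_trunc by (intro eventually_sequentiallyI[of k]) simp
  from Lim_transform_eventually[OF lim this] show "coord (T x) (Suc k) = \<alpha> k * coord x k"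
    by (simp add: LIMSEQ_const_iff)
qed

definition T' :: "ell2 \<Rightarrow> ell2"
  where "T' x = mult_op (\<lambda>k. cnj (\<alpha> k)) (left_shift x)"

lemma coord_T': "coord (T' x) k = cnj (\<alpha> k) * coord x (Suc k)"
  by (simp add: T'_def coord_mult_op[OF bounded_range_cnj[OF \<alpha>]] coord_left_shift)

lemma adjoint_pair_weighted_shift: "adjoint_pair T T'"
proof -
  have "bounded_clinear T'"
    unfolding T'_def[abs_def]
    by (rule bounded_clinear_compose[OF bounded_clinear_mult_op[OF bounded_range_cnj[OF \<alpha>]]
        bounded_clinear_left_shift])
  \<comment> \<open>The coordinate of \<open>T x\<close> at 0 vanishes, so dropping the head of the
    series shifts its index by one.\<close>
  moreover have "inner (T x) y = inner x (T' y)" for x y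
    using suminf_split_head[OF summable_inner, of "T x" y]
    by (simp add: inner_ell2 coord_weighted_shift coord_T' algebra_simps)
  ultimately show ?thesis using T by (simp add: adjoint_pair_def)
qed

lemma adjoint_on_weighted_shift: "adjoint_on UNIV T = T'"
  by (rule ext) (simp add: adjoint_on_eq[OF adjoint_pair_weighted_shift ell2.subspace_UNIV])

lemma T'_funpow_trunc:
  assumes "x \<in> range (trunc n)"
  shows "(T' ^^ j) x \<in> range (trunc n)"
proof (induction j)
  case (Suc j)
  then show ?case
    unfolding range_trunc_iff_coord by (simp add: coord_T')
qed (use assms in simp)

lemma norm_funpow_le: "norm ((T ^^ j) x) \<le> onorm T ^ j * norm x"
proof (induction j)
  case (Suc j)
  have "norm (T ((T ^^ j) x)) \<le> onorm T * norm ((T ^^ j) x)"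
    by (rule bounded_clinearD(8)[OF T])
  also have "\<dots> \<le> onorm T * (onorm T ^ j * norm x)"
    by (intro mult_left_mono Suc.IH bounded_clinearD(9)[OF T])
  finally show ?case by (simp add: mult.assoc)
qed simp

lemma off_trunc_weighted_shift_le:
  assumes "x \<in> range (trunc n)"
  shows "norm (T x - trunc n (T x)) \<le> cmod (\<alpha> n) * norm x"
proof -
  have x: "coord x k = 0" if "k > n" for k
    using assms that by (simp add: range_trunc_iff_coord)
  have "T x - trunc n (T x) = (\<alpha> n * coord x n) *\<^sub>C \<delta> (Suc n)"
  proof (rule ell2_eqI)
    fix k
    show "coord (T x - trunc n (T x)) k = coord ((\<alpha> n * coord x n) *\<^sub>C \<delta> (Suc n)) k"
      by (cases k)
        (auto simp: coord_simps coord_trunc coord_weighted_shift coord_cscale coord_ebasis x)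
  qed
  then show ?thesis
    by (simp add: norm_cscale norm_ebasis norm_mult mult_left_mono norm_coord_le)
qed

text \<open>A product rule, and the origin of the derivative of \<open>q\<close>: mass may leave the
  truncated space at any of the \<open>j\<close> applications of \<open>T\<close>. One application
  costs \<open>cmod (\<alpha> n)\<close>, the remaining ones a factor \<open>onorm T\<close>
  each.\<close>

lemma off_trunc_funpow_le:
  assumes "x \<in> range (trunc n)"
  shows "norm ((T ^^ j) x - trunc n ((T ^^ j) x)) \<le> real j * onorm T ^ (j - 1) * cmod (\<alpha> n) * norm x"
proof (induction j)
  case 0
  then show ?case using assms by (simp add: range_trunc_iff)
next
  case (Suc j)
  let ?t = "onorm T"
  let ?w = "(T ^^ j) x"
  let ?v = "trunc n ?w" and ?u = "?w - trunc n ?w"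
  have t0: "?t \<ge> 0" by (rule bounded_clinearD(9)[OF T])
  \<comment> \<open>The part still inside can leave only through the weight at \<open>n\<close>; the
    part already outside is controlled by induction.\<close>
  have "T ?w - trunc n (T ?w) = (T ?v - trunc n (T ?v)) + (T ?u - trunc n (T ?u))"
    by (simp add: bounded_clinearD(4)[OF T] bounded_clinearD(4)[OF bounded_clinear_trunc])
  then have "norm (T ?w - trunc n (T ?w)) \<le> norm (T ?v - trunc n (T ?v)) + norm (T ?u - trunc n (T ?u))"
    by (simp only: norm_triangle_ineq)
  also have "\<dots> \<le> cmod (\<alpha> n) * (?t ^ j * norm x)
      + ?t * (real j * ?t ^ (j - 1) * cmod (\<alpha> n) * norm x)"
  proof (rule add_mono)
    have "norm (T ?v - trunc n (T ?v)) \<le> cmod (\<alpha> n) * norm ?v"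
      by (rule off_trunc_weighted_shift_le) simp
    also have "\<dots> \<le> cmod (\<alpha> n) * (?t ^ j * norm x)"
      by (rule mult_left_mono[OF order_trans[OF norm_trunc_le norm_funpow_le]]) simp
    finally show "norm (T ?v - trunc n (T ?v)) \<le> cmod (\<alpha> n) * (?t ^ j * norm x)" .
    have "norm (T ?u - trunc n (T ?u)) \<le> ?t * norm ?u"
      by (rule order_trans[OF norm_diff_trunc_le bounded_clinearD(8)[OF T]])
    also have "\<dots> \<le> ?t * (real j * ?t ^ (j - 1) * cmod (\<alpha> n) * norm x)"
      by (rule mult_left_mono[OF Suc.IH t0])
    finally show "norm (T ?u - trunc n (T ?u)) \<le> ?t * (real j * ?t ^ (j - 1) * cmod (\<alpha> n) * norm x)" .
  qed
  \<comment> \<open>The case split is due to \<open>j - 1\<close> being cut off at 0; the factor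
    \<open>real j\<close> vanishes there.\<close>
  also have "\<dots> = real (Suc j) * ?t ^ (Suc j - 1) * cmod (\<alpha> n) * norm x"
    by (cases j) (simp_all add: algebra_simps)
  finally show ?case by simp
qed

text \<open>Only the positive powers of the shift leave the truncated space. This is why a single
  \<open>q'(\<parallel>T\<parallel>)\<close>, rather than twice that number, bounds the off-diagonal parts of a band operator
  and of its adjoint.\<close>

context
  fixes m :: nat and g h :: "nat \<Rightarrow> nat \<Rightarrow> complex" and f0 :: "nat \<Rightarrow> complex" and M :: real
  assumes g: "\<And>j. j \<in> {1..m} \<Longrightarrow> bounded (range (g j))"
    and h: "\<And>j. j \<in> {1..m} \<Longrightarrow> bounded (range (h j))" and f0: "bounded (range f0)"
    and g_le: "\<And>j n. j \<in> {1..m} \<Longrightarrow> cmod (g j n) \<le> M"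
    and h_le: "\<And>j n. j \<in> {1..m} \<Longrightarrow> cmod (h j n) \<le> M"
begin

definition band :: "ell2 \<Rightarrow> ell2"
  where "band x = (\<Sum>j=1..m. mult_op (g j) ((T' ^^ j) x)) + mult_op f0 x
    + (\<Sum>j=1..m. mult_op (h j) ((T ^^ j) x))"

definition band' :: "ell2 \<Rightarrow> ell2"
  where "band' x = (\<Sum>j=1..m. (T ^^ j) (mult_op (\<lambda>n. cnj (g j n)) x)) + mult_op (\<lambda>n. cnj (f0 n)) x
    + (\<Sum>j=1..m. (T' ^^ j) (mult_op (\<lambda>n. cnj (h j n)) x))"

lemma adjoint_pair_band: "adjoint_pair band band'"
proof -
  have 1: "adjoint_pair (\<lambda>x. mult_op (g j) ((T' ^^ j) x)) (\<lambda>x. (T ^^ j) (mult_op (\<lambda>n. cnj (g j n)) x))"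
    if "j \<in> {1..m}" for j
    by (rule adjoint_pair_compose[OF adjoint_pair_mult_op[OF g[OF that]]
          adjoint_pair_funpow[OF adjoint_pair_sym[OF adjoint_pair_weighted_shift]]])
  have 2: "adjoint_pair (\<lambda>x. mult_op (h j) ((T ^^ j) x)) (\<lambda>x. (T' ^^ j) (mult_op (\<lambda>n. cnj (h j n)) x))"
    if "j \<in> {1..m}" for j
    by (rule adjoint_pair_compose[OF adjoint_pair_mult_op[OF h[OF that]]
          adjoint_pair_funpow[OF adjoint_pair_weighted_shift]])
  show ?thesis
    unfolding band_def[abs_def] band'_def[abs_def]
    by (rule adjoint_pair_add[OF adjoint_pair_add[OF adjoint_pair_sum[OF 1] adjoint_pair_mult_op[OF f0]]
          adjoint_pair_sum[OF 2]])
qed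

text \<open>Multiplication operators commute with truncation and powers of \<open>T'\<close>
  preserve its range, so only the powers of \<open>T\<close> contribute, each with a factor
  \<open>M\<close> from its coefficient.\<close>

lemma off_trunc_band_le:
  assumes x: "x \<in> range (trunc n)"
  shows "norm (band x - trunc n (band x))
    \<le> M * (\<Sum>j=1..m. real j * onorm T ^ (j - 1)) * cmod (\<alpha> n) * norm x"
proof -
  have "trunc n (mult_op (g j) ((T' ^^ j) x)) = mult_op (g j) ((T' ^^ j) x)" if "j \<in> {1..m}" for j
    using T'_funpow_trunc[OF x, of j] mult_op_trunc[OF g[OF that]] by (metis range_trunc_iff)
  then have fix1: "trunc n (\<Sum>j=1..m. mult_op (g j) ((T' ^^ j) x)) = (\<Sum>j=1..m. mult_op (g j) ((T' ^^ j) x))"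
    unfolding trunc_sum by (rule sum.cong[OF refl])
  have fix2: "trunc n (mult_op f0 x) = mult_op f0 x"
    using x mult_op_trunc[OF f0] by (metis range_trunc_iff)
  let ?s = "\<Sum>j=1..m. mult_op (h j) ((T ^^ j) x)"
  have "band x - trunc n (band x) = ?s - trunc n ?s"
    unfolding band_def bounded_clinearD(3)[OF bounded_clinear_trunc] fix1 fix2 by simp
  also have "norm \<dots> \<le> (\<Sum>j=1..m. M * (real j * onorm T ^ (j - 1) * cmod (\<alpha> n) * norm x))"
  proof (rule off_trunc_sum_le)
    fix j assume j: "j \<in> {1..m}"
    let ?w = "(T ^^ j) x"
    have M: "M \<ge> 0" using h_le[OF j, of 0] norm_ge_zero order_trans by blast
    have "mult_op (h j) ?w - trunc n (mult_op (h j) ?w) = mult_op (h j) (?w - trunc n ?w)"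
      by (simp add: mult_op_trunc[OF h[OF j]] bounded_clinearD(4)[OF bounded_clinear_mult_op[OF h[OF j]]])
    then have "norm (mult_op (h j) ?w - trunc n (mult_op (h j) ?w)) \<le> M * norm (?w - trunc n ?w)"
      using mult_op_norm_le[OF h[OF j] h_le[OF j]] by simp
    also have "\<dots> \<le> M * (real j * onorm T ^ (j - 1) * cmod (\<alpha> n) * norm x)"
      by (intro mult_left_mono off_trunc_funpow_le x M)
    finally show "norm (mult_op (h j) ?w - trunc n (mult_op (h j) ?w))
      \<le> M * (real j * onorm T ^ (j - 1) * cmod (\<alpha> n) * norm x)" .
  qed
  also have "\<dots> = M * (\<Sum>j=1..m. real j * onorm T ^ (j - 1)) * cmod (\<alpha> n) * norm x"
    by (simp add: sum_distrib_left sum_distrib_right mult.assoc)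
  finally show ?thesis .
qed

text \<open>Taking adjoints swaps the roles of \<open>g\<close> and \<open>h\<close>. The
  multiplications now act first, but they keep \<open>x\<close> in the truncated space.\<close>

lemma off_trunc_band'_le:
  assumes x: "x \<in> range (trunc n)"
  shows "norm (band' x - trunc n (band' x))
    \<le> M * (\<Sum>j=1..m. real j * onorm T ^ (j - 1)) * cmod (\<alpha> n) * norm x"
proof -
  have mult: "mult_op (\<lambda>n. cnj (f n)) x \<in> range (trunc n)" if "bounded (range f)" for f
    using x mult_op_trunc[OF bounded_range_cnj[OF that]] by (metis range_trunc_iff)
  have "trunc n ((T' ^^ j) (mult_op (\<lambda>n. cnj (h j n)) x)) = (T' ^^ j) (mult_op (\<lambda>n. cnj (h j n)) x)"
    if "j \<in> {1..m}" for j
    using T'_funpow_trunc[OF mult[OF h[OF that]]] by (simp only: range_trunc_iff)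
  then have fix1: "trunc n (\<Sum>j=1..m. (T' ^^ j) (mult_op (\<lambda>n. cnj (h j n)) x))
      = (\<Sum>j=1..m. (T' ^^ j) (mult_op (\<lambda>n. cnj (h j n)) x))"
    unfolding trunc_sum by (rule sum.cong[OF refl])
  have fix2: "trunc n (mult_op (\<lambda>n. cnj (f0 n)) x) = mult_op (\<lambda>n. cnj (f0 n)) x"
    using mult[OF f0] by (simp only: range_trunc_iff)
  let ?s = "\<Sum>j=1..m. (T ^^ j) (mult_op (\<lambda>n. cnj (g j n)) x)"
  have "band' x - trunc n (band' x) = ?s - trunc n ?s"
    unfolding band'_def bounded_clinearD(3)[OF bounded_clinear_trunc] fix1 fix2 by simp
  also have "norm \<dots> \<le> (\<Sum>j=1..m. real j * onorm T ^ (j - 1) * cmod (\<alpha> n) * (M * norm x))"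
  proof (rule off_trunc_sum_le)
    fix j assume j: "j \<in> {1..m}"
    let ?y = "mult_op (\<lambda>n. cnj (g j n)) x"
    have "norm ((T ^^ j) ?y - trunc n ((T ^^ j) ?y)) \<le> real j * onorm T ^ (j - 1) * cmod (\<alpha> n) * norm ?y"
      by (rule off_trunc_funpow_le[OF mult[OF g[OF j]]])
    also have "\<dots> \<le> real j * onorm T ^ (j - 1) * cmod (\<alpha> n) * (M * norm x)"
      using g_le[OF j] bounded_clinearD(9)[OF T]
      by (intro mult_left_mono mult_op_norm_le bounded_range_cnj g j) auto
    finally show "norm ((T ^^ j) ?y - trunc n ((T ^^ j) ?y))
      \<le> real j * onorm T ^ (j - 1) * cmod (\<alpha> n) * (M * norm x)" .
  qed
  also have "\<dots> = M * (\<Sum>j=1..m. real j * onorm T ^ (j - 1)) * cmod (\<alpha> n) * norm x"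
    by (simp add: sum_distrib_left sum_distrib_right algebra_simps)
  finally show ?thesis .
qed

end

end

section \<open>Invertibility, the solution error, and the final assembly\<close>

lemma deriv_sum_powers:
  fixes t :: real
  shows "deriv (\<lambda>x. \<Sum>j=1..m. x ^ j) t = (\<Sum>j=1..m. real j * t ^ (j - 1))"
  by (rule DERIV_imp_deriv) (auto intro!: derivative_eq_intros sum.cong)

lemma norm_le_onorm_inv:
  assumes B: "bounded_clinear B" and inv: "invertible_on UNIV B"
  shows "norm x \<le> onorm (inv B) * norm (B x)" and "onorm (inv B) > 0" and "surj B"
proof -
  obtain C where C: "\<And>x. x \<in> UNIV \<Longrightarrow> norm (inv B x) \<le> C * norm x" and bij: "bij B"
    using inv by (auto simp: invertible_on_def)
  have le: "norm x \<le> onorm (inv B) * norm (B x)" for x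
    using onorm_on_bound[OF C, where V = UNIV and x = "B x"] bij
    by (simp add: onorm_on_UNIV inv_f_f bij_is_inj)
  then show "norm x \<le> onorm (inv B) * norm (B x)" .
  show "onorm (inv B) > 0"
  proof (rule ccontr)
    assume "\<not> onorm (inv B) > 0"
    then have "onorm (inv B) * norm (B (\<delta> 0)) \<le> 0"
      by (intro mult_nonpos_nonneg) auto
    then show False using le[of "\<delta> 0"] by (simp add: norm_ebasis)
  qed
  show "surj B" using bij by (rule bij_is_surj)
qed

context truncation
begin

text \<open>Stated for the resolvent at 0, which is \<open>S\<close> up to sign, so that (1) can
  reuse the transfer of lower bounds to truncations.\<close>

lemma S_below_of_invertible:
  assumes "invertible_on UNIV S"
  shows "1 / onorm (inv S) * norm x \<le> norm (resolvent_op 0 S x)"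
  using norm_le_onorm_inv(1)[OF clinear_S assms, of x] norm_le_onorm_inv(2)[OF clinear_S assms]
  by (simp add: resolvent_op_def field_simps)

lemma A_invertible:
  assumes inv: "invertible_on UNIV S" and small: "onorm (inv S) * c k < 1"
  shows "invertible_on (U k) (A k)"
proof -
  have pos: "onorm (inv S) > 0" by (rule norm_le_onorm_inv(2)[OF clinear_S inv])
  define e where "e = 1 / onorm (inv S) - c k"
  have "e > 0" using pos small by (simp add: e_def field_simps)
  have below: "e * norm x \<le> norm (A k x)" if "x \<in> U k" for x
    using resolvent_below_transfer[OF S_below_of_invertible[OF inv] that]
    by (simp add: resolvent_op_def e_def)
  show ?thesis
    unfolding invertible_on_iff[OF clinear_A subspace_range_trunc A_image]
    using bounded_below_on_range_trunc_imp_surj[OF clinear_A A_image \<open>e > 0\<close> below] \<open>e > 0\<close> below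
    by blast
qed

text \<open>Applying \<open>S\<close> to the error leaves the part of \<open>S x\<^sub>k\<close>
  outside the truncated space minus the discarded part of \<open>y\<close>.\<close>

lemma truncated_solution_error:
  assumes inv: "invertible_on UNIV S" and "S x = y" "x\<^sub>k \<in> U k" "A k x\<^sub>k = P k y"
  shows "norm (x\<^sub>k - x) \<le> onorm (inv S) * (norm (y - P k y) + norm x\<^sub>k * c k)"
proof -
  have "S (x\<^sub>k - x) = (S x\<^sub>k - P k (S x\<^sub>k)) - (y - P k y)"
    using assms(2-4) by (simp add: bounded_clinearD(4)[OF clinear_S] A_def range_trunc_iff)
  then have "norm (S (x\<^sub>k - x)) \<le> norm (S x\<^sub>k - P k (S x\<^sub>k)) + norm (y - P k y)"
    by (simp only: norm_triangle_ineq4)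
  also have "\<dots> \<le> norm (y - P k y) + norm x\<^sub>k * c k"
    using off[OF assms(3)] by (simp add: mult.commute)
  finally have "onorm (inv S) * norm (S (x\<^sub>k - x)) \<le> onorm (inv S) * (norm (y - P k y) + norm x\<^sub>k * c k)"
    using norm_le_onorm_inv(2)[OF clinear_S inv] by (intro mult_left_mono) auto
  then show ?thesis
    using norm_le_onorm_inv(1)[OF clinear_S inv, of "x\<^sub>k - x"] by (rule order_trans[rotated])
qed

end

theorem theorem7p1:
  fixes \<alpha> :: "nat \<Rightarrow> complex"
    and T S :: "ell2 \<Rightarrow> ell2"
    and i :: "nat \<Rightarrow> nat"
    and m :: nat
    and f :: "int \<Rightarrow> nat \<Rightarrow> complex"
    and q :: "real \<Rightarrow> real"
    and M :: real
    and V :: "nat \<Rightarrow> ell2 set"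
    and P A :: "nat \<Rightarrow> ell2 \<Rightarrow> ell2"
  assumes "bounded (range \<alpha>)"
    and "bounded_clinear T"
    and "\<forall>n. T (\<delta> n) = \<alpha> n *\<^sub>C \<delta> (Suc n)"
    and "strict_mono i"
    and "(\<lambda>k. cmod (\<alpha> (i k))) \<longlonglongrightarrow> 0"
    and "m \<ge> 1"
    and "\<forall>j\<in>{- int m..int m}. bounded (range (f j))"
    and "S = (\<lambda>x. (\<Sum>j=1..m. mult_op (f (- int j)) ((adjoint_on UNIV T ^^ j) x))
                 + mult_op (f 0) x
                 + (\<Sum>j=1..m. mult_op (f (int j)) ((T ^^ j) x)))"
    and "q = (\<lambda>x. \<Sum>j=1..m. x ^ j)"
    and "M = Max ((\<lambda>j. SUP n. cmod (f j n)) ` {- int m..int m})"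
    and "V = (\<lambda>k. cspan (\<delta> ` {..i k}))"
    and "P = (\<lambda>k. orth_proj (V k))"
    and "A = (\<lambda>k. P k \<circ> S \<circ> P k)"
  shows
    "(\<comment> \<open>(1)\<close>
      \<forall>k. invertible_on UNIV S \<and>
          cmod (\<alpha> (i k)) < 1 / (onorm (inv S) * M * deriv q (onorm T)) \<longrightarrow>
          invertible_on (V k) (A k)) \<and>
     (\<comment> \<open>(2)\<close>
      \<forall>k x y x\<^sub>k. invertible_on UNIV S \<and>
          cmod (\<alpha> (i k)) < 1 / (onorm (inv S) * M * deriv q (onorm T)) \<and>
          S x = y \<and> x\<^sub>k \<in> V k \<and> A k x\<^sub>k = P k y \<longrightarrow>
          norm (x\<^sub>k - x) \<le> onorm (inv S) *
            (norm (y - P k y) + norm x\<^sub>k * M * deriv q (onorm T) * cmod (\<alpha> (i k)))) \<and>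
     (\<comment> \<open>(3)\<close>
      \<forall>\<epsilon>>0. set_tendsto (\<lambda>k. pseudospectrum_on (V k) \<epsilon> (A k)) (pseudospectrum_on UNIV \<epsilon> S) \<and>
          (\<forall>k. pseudospectrum_on (V k) \<epsilon> (A k) \<subseteq>
               pseudospectrum_on UNIV (\<epsilon> + M * deriv q (onorm T) * cmod (\<alpha> (i k))) S)) \<and>
     (\<comment> \<open>(4), singular value 0 included\<close>
      set_tendsto (\<lambda>k. singular_values0_on (V k) (A k)) (singular_values0_on UNIV S) \<and>
      (\<forall>k. singular_values0_on (V k) (A k) \<subseteq>
           nbhd (sqrt (2 * onorm S * M * deriv q (onorm T) * cmod (\<alpha> (i k))))
             (singular_values0_on UNIV S))) \<and>
     (\<comment> \<open>(4), positive singular values only\<close>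
      (0 \<in> spectrum_on UNIV (adjoint_on UNIV S \<circ> S) \<longrightarrow>
         0 islimpt spectrum_on UNIV (adjoint_on UNIV S \<circ> S)) \<longrightarrow>
      set_tendsto (\<lambda>k. singular_values_on (V k) (A k)) (singular_values_on UNIV S) \<and>
      (\<forall>k. singular_values_on (V k) (A k) \<subseteq>
           nbhd (sqrt (2 * onorm S * M * deriv q (onorm T) * cmod (\<alpha> (i k))))
             (singular_values_on UNIV S)))"
proof -
  note \<alpha> = assms(1) and T = assms(2) and T_ebasis = assms(3)[rule_format] and f = assms(7)[rule_format]
  define c where "c k = M * deriv q (onorm T) * cmod (\<alpha> (i k))" for k
  have f_le: "cmod (f j n) \<le> M" if "j \<in> {- int m..int m}" for j n
  proof -
    have "cmod (f j n) \<le> (SUP n. cmod (f j n))"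
      using f[OF that] by (intro cSUP_upper) (auto simp: bounded_iff bdd_above_def)
    also have "\<dots> \<le> M"
      unfolding assms(10) using that by (intro Max_ge) auto
    finally show ?thesis .
  qed
  have M: "M \<ge> 0" using order_trans[OF norm_ge_zero f_le[of 0 0]] by simp
  have q: "deriv q (onorm T) = (\<Sum>j=1..m. real j * onorm T ^ (j - 1))"
    unfolding assms(9) by (rule deriv_sum_powers)
  have q0: "deriv q (onorm T) \<ge> 0"
    unfolding q by (intro sum_nonneg mult_nonneg_nonneg zero_le_power bounded_clinearD(9)[OF T]) auto
  let ?g = "\<lambda>j. f (- int j)" and ?h = "\<lambda>j. f (int j)"
  let ?S' = "band' \<alpha> T m ?g ?h (f 0)"
  have g: "\<And>j. j \<in> {1..m} \<Longrightarrow> bounded (range (?g j))" and h: "\<And>j. j \<in> {1..m} \<Longrightarrow> bounded (range (?h j))"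
    and f0: "bounded (range (f 0))"
    using f by auto
  have g_le: "\<And>j n. j \<in> {1..m} \<Longrightarrow> cmod (?g j n) \<le> M" and h_le: "\<And>j n. j \<in> {1..m} \<Longrightarrow> cmod (?h j n) \<le> M"
    using f_le by auto
  note band = \<alpha> T T_ebasis g h f0 g_le h_le
  have S: "S = band \<alpha> T m ?g ?h (f 0)"
    unfolding assms(8) adjoint_on_weighted_shift[OF \<alpha> T T_ebasis]
    by (rule ext, rule band_def[OF band, symmetric])
  interpret tr: truncation S ?S' i c
  proof
    show "adjoint_pair S ?S'"
      unfolding S by (rule adjoint_pair_band[OF band])
    show "filterlim i at_top sequentially"
      using assms(4) by (rule filterlim_subseq)
    show "c \<longlonglongrightarrow> 0"
      unfolding c_def[abs_def] using tendsto_mult[OF tendsto_const assms(5)] by simp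
    show "c k \<ge> 0" for k unfolding c_def using M q0 by simp
    show "norm (S x - trunc (i k) (S x)) \<le> c k * norm x" if "x \<in> range (trunc (i k))" for k x
      using off_trunc_band_le[OF band that] by (simp add: S c_def q)
    show "norm (?S' x - trunc (i k) (?S' x)) \<le> c k * norm x" if "x \<in> range (trunc (i k))" for k x
      using off_trunc_band'_le[OF band that] by (simp add: c_def q)
  qed
  have V: "V k = range (trunc (i k))" for k unfolding assms(11) cspan_ebasis ..
  have P: "P k = trunc (i k)" for k unfolding assms(12) V by (rule orth_proj_range_trunc)
  have A: "A k = tr.A k" for k unfolding assms(13) P tr.A_def ..
  have small: "onorm (inv S) * c k < 1"
    if "invertible_on UNIV S" "cmod (\<alpha> (i k)) < 1 / (onorm (inv S) * M * deriv q (onorm T))" for k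
  proof -
    \<comment> \<open>As \<open>1 / 0 = 0\<close>, the strict bound on the weight itself forces the
      denominator to be positive, so it can be cleared.\<close>
    have "0 < 1 / (onorm (inv S) * M * deriv q (onorm T))"
      using that(2) norm_ge_zero[of "\<alpha> (i k)"] by linarith
    then have "0 < onorm (inv S) * M * deriv q (onorm T)" by simp
    then show ?thesis using that(2) by (simp add: c_def field_simps)
  qed
  have eqs: "norm x * M * deriv q (onorm T) * cmod (\<alpha> (i k)) = norm x * c k"
    "M * deriv q (onorm T) * cmod (\<alpha> (i k)) = c k"
    "2 * onorm S * M * deriv q (onorm T) * cmod (\<alpha> (i k)) = 2 * onorm S * c k" for x :: ell2 and k
    by (simp_all add: c_def)
  show ?thesis
    unfolding eqs V P A tr.spectrum_S
    using tr.A_invertible small tr.truncated_solution_error tr.pseudospectrum_A_tendsto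
      tr.pseudospectrum_A_subset tr.singular_values0_A_tendsto tr.singular_values0_A_subset
      tr.singular_values_A_tendsto tr.singular_values_A_subset
    by (intro conjI allI impI) blast+
qed

end
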